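(* Let $p=3\mu$ with $\mu\in\{-1,1\}$ and $q=3$, let $\tau\in\mathbb{C}$ satisfy $\tau^2-p\tau+q=0$, let $w\ge 2$ be an integer and let $\mathcal{D}$ be the minimal norm representatives digit set modulo $\tau^w$. Then the $w$-NAF-expansion (base $\tau$, digit set $\mathcal{D}$) of each element of $\mathbb{Z}[\tau]$ is optimal.
   Context: Voronoi cell: $V=\{z\in\mathbb{C}:\ |z|\le|z-y|\text{ for all }y\in\mathbb{Z}[\tau]\}$. Writing $\{x\}$ for the fractional part and $r=\{\mathrm{Re}\,\tau\}$, $t=\mathrm{Im}\,\tau$, its vertices, in cyclic order, are $v_0=\frac12+\frac{i}{2t}(t^2+r^2-r)$, $v_1=r-\frac12+\frac{i}{2t}(t^2-r^2+r)$, $v_2=v_0-1$, $v_3=-v_0$, $v_4=-v_1$, $v_5=-v_2$; if $\mathrm{Re}\,\tau\in\mathbb{Z}$ then $v_1=v_2$ and $v_4=v_5$ and $V$ is a rectangle. Let $m\in\{4,6\}$ be the number of distinct vertices and relabel the distinct vertices in this order as $v_0,\dots,v_{m-1}$ (indices modulo $m$); let $v_{k+1/2}$ be the midpoint of the segment from $v_k$ to $v_{k+1}$. The restricted Voronoi cell $\widetilde V$ consists of the interior of $V$, the open segments from $v_{k+1/2}$ to $v_{k+1}$ (both endpoints excluded) for all $k$, the points $v_{k+1/2}$ for $k\in\{0,\dots,\lfloor m/2\rfloor-1\}$, and the points $v_k$ for $k\in\{1,\dots,\lfloor m/3\rfloor\}$. Minimal norm representatives digit set modulo $\tau^w$: the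 set $\mathcal{D}\subseteq\mathbb{Z}[\tau]$ consisting of $0$ and of exactly one representative of each residue class of $\mathbb{Z}[\tau]$ modulo $\tau^w$ that is not divisible by $\tau$, namely the one lying in $\tau^w\widetilde V$. A multi-expansion of $z\in\mathbb{Z}[\tau]$ is a finite multiset of pairs $(d,n)\in(\mathcal{D}\setminus\{0\})\times\mathbb{N}_0$ with $\sum d\,\tau^n=z$; its weight is its cardinality counted with multiplicity. An expansion is a multi-expansion in which the exponents $n$ are pairwise distinct, identified with a finitely supported sequence $(\eta_n)_{n\in\mathbb{N}_0}\in\mathcal{D}^{\mathbb{N}_0}$ with $\sum_n\eta_n\tau^n=z$. A $w$-NAF-expansion is an expansion such that every block of $w$ consecutive digits $\eta_{j+w-1}\ldots\eta_j$ contains at most one non-zero digit. With this digit set, every element of $\mathbb{Z}[\tau]$ has exactly one $w$-NAF-expansion (a known theorem). An expansion of $z$ is optimal if its weight is at most the weight of every multi-expansion of $z$. *)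

theory Defs
  imports "HOL-Analysis.Analysis" "HOL-Computational_Algebra.Polynomial" "HOL-Library.Multiset"
begin

text \<open>The ring \<open>\<int>[\<tau>]\<close>, as the set of values at \<open>\<tau>\<close> of integer polynomials.\<close>

definition int_adjoin :: "complex \<Rightarrow> complex set" where
  "int_adjoin \<tau> = range (\<lambda>f :: int poly. poly (map_poly of_int f) \<tau>)"

definition dvd_in :: "complex set \<Rightarrow> complex \<Rightarrow> complex \<Rightarrow> bool" where
  "dvd_in R a b \<longleftrightarrow> (\<exists>y\<in>R. b = a * y)"

definition voronoi_cell :: "complex \<Rightarrow> complex set" where
  "voronoi_cell \<tau> = {z. \<forall>y\<in>int_adjoin \<tau>. norm z \<le> norm (z - y)}"

text \<open>The list of distinct vertices. If \<open>Re \<tau>\<close> is an integer, the second and third, and the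
  fifth and sixth entries coincide; these are neighbours, so \<open>remdups\<close> (which retains
  last occurrences) respects the cyclic order.\<close>

definition voronoi_vertices :: "complex \<Rightarrow> complex list" where
  "voronoi_vertices \<tau> =
     (let r = frac (Re \<tau>); t = Im \<tau>;
          v0 = Complex (1/2) ((t\<^sup>2 + r\<^sup>2 - r) / (2 * t));
          v1 = Complex (r - 1/2) ((t\<^sup>2 - r\<^sup>2 + r) / (2 * t));
          v2 = v0 - 1
      in remdups [v0, v1, v2, - v0, - v1, - v2])"

definition voronoi_vertex :: "complex \<Rightarrow> nat \<Rightarrow> complex" where
  "voronoi_vertex \<tau> k = voronoi_vertices \<tau> ! (k mod length (voronoi_vertices \<tau>))"

definition voronoi_edge_midpoint :: "complex \<Rightarrow> nat \<Rightarrow> complex" where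
  "voronoi_edge_midpoint \<tau> k = midpoint (voronoi_vertex \<tau> k) (voronoi_vertex \<tau> (k + 1))"

definition restricted_voronoi_cell :: "complex \<Rightarrow> complex set" where
  "restricted_voronoi_cell \<tau> =
     (let m = length (voronoi_vertices \<tau>)
      in interior (voronoi_cell \<tau>)
         \<union> (\<Union>k<m. open_segment (voronoi_edge_midpoint \<tau> k) (voronoi_vertex \<tau> (k + 1)))
         \<union> voronoi_edge_midpoint \<tau> ` {0..<m div 2}
         \<union> voronoi_vertex \<tau> ` {1..m div 3})"

text \<open>Since the translates of the restricted cell by elements of \<open>\<int>[\<tau>]\<close> tile the plane
  (for \<open>\<tau>\<close> an imaginary quadratic integer), each residue class modulo \<open>\<tau> ^ w\<close> has exactly one
  element in \<open>\<tau> ^ w\<close> times that cell. Divisibility by \<open>\<tau>\<close> depends only on the residue class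
  (for \<open>w \<ge> 1\<close>), so the set below contains, besides 0, exactly one representative of each
  residue class not divisible by \<open>\<tau>\<close>.\<close>

definition min_norm_digit_set :: "complex \<Rightarrow> nat \<Rightarrow> complex set" where
  "min_norm_digit_set \<tau> w =
     {0} \<union> {d \<in> int_adjoin \<tau>. \<not> dvd_in (int_adjoin \<tau>) \<tau> d
                              \<and> d \<in> (\<lambda>v. \<tau> ^ w * v) ` restricted_voronoi_cell \<tau>}"

definition is_multi_expansion ::
  "complex \<Rightarrow> complex set \<Rightarrow> complex \<Rightarrow> (complex \<times> nat) multiset \<Rightarrow> bool" where
  "is_multi_expansion \<tau> D z M \<longleftrightarrow>
     set_mset M \<subseteq> (D - {0}) \<times> UNIV \<and> (\<Sum>(d, n)\<in>#M. d * \<tau> ^ n) = z"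

definition is_expansion ::
  "complex \<Rightarrow> complex set \<Rightarrow> complex \<Rightarrow> (nat \<Rightarrow> complex) \<Rightarrow> bool" where
  "is_expansion \<tau> D z \<eta> \<longleftrightarrow>
     (\<forall>n. \<eta> n \<in> D) \<and> finite {n. \<eta> n \<noteq> 0} \<and> (\<Sum>n | \<eta> n \<noteq> 0. \<eta> n * \<tau> ^ n) = z"

text \<open>The cardinality of the multi-expansion identified with \<open>\<eta>\<close>, which consists of the pairs
  \<open>(\<eta> n, n)\<close> with \<open>\<eta> n \<noteq> 0\<close>, once each.\<close>

definition expansion_weight :: "(nat \<Rightarrow> complex) \<Rightarrow> nat" where
  "expansion_weight \<eta> = card {n. \<eta> n \<noteq> 0}"

definition is_wNAF_expansion ::
  "complex \<Rightarrow> nat \<Rightarrow> complex set \<Rightarrow> complex \<Rightarrow> (nat \<Rightarrow> complex) \<Rightarrow> bool" where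
  "is_wNAF_expansion \<tau> w D z \<eta> \<longleftrightarrow>
     is_expansion \<tau> D z \<eta> \<and> (\<forall>j. card {n \<in> {j..<j + w}. \<eta> n \<noteq> 0} \<le> 1)"

definition is_optimal_expansion ::
  "complex \<Rightarrow> complex set \<Rightarrow> complex \<Rightarrow> (nat \<Rightarrow> complex) \<Rightarrow> bool" where
  "is_optimal_expansion \<tau> D z \<eta> \<longleftrightarrow>
     is_expansion \<tau> D z \<eta> \<and> (\<forall>M. is_multi_expansion \<tau> D z M \<longrightarrow> expansion_weight \<eta> \<le> size M)"

end

theory Submission
  imports Defs
begin

text \<open>
For \<open>p = 3\<mu>\<close> and \<open>q = 3\<close> the ring \<open>\<int>[\<tau>]\<close> is the ring of Eisenstein integers, a hexagonal
lattice, and \<open>\<tau>\<close> is a prime of absolute value \<open>sqrt 3\<close> dividing 3.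

Optimality reduces to a statement about two terms (locale \<open>digit_system\<close>): if every sum
\<open>a + \<tau> ^ k * b\<close> of two digits with \<open>k < w\<close> has a multi-expansion of weight at most two with at
most one term among the places below \<open>w\<close>, then in any multi-expansion the terms at these places can be
merged, without increasing the weight, until at most one is left (\<open>thin_multi_expansion\<close>).
From then on the multi-expansion and the \<open>w\<close>-NAF agree in their lowest digit, because digits
are determined by their residue class, and one proceeds to the higher places (\<open>wNAF_weight_le\<close>).

The two-term statement (\<open>digit_merge\<close>) is a question of size. Write the sum, freed from powers
of \<open>\<tau>\<close>, as \<open>s = e + \<tau> ^ w * g\<close> with \<open>e\<close> the digit of its residue class. Digits are bounded
by the circumradius \<open>sqrt 3 ^ (w - 1)\<close> of the hexagon \<open>\<tau> ^ w * V\<close>, so \<open>g\<close> has absolute value at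
most about \<open>sqrt 3 ^ (w - 2)\<close>. This is smaller than the inradius \<open>sqrt 3 ^ w / 2\<close>, with
enough room for the lower-order terms (\<open>digits_short\<close>; for \<open>w = 2\<close> and \<open>w = 3\<close> this takes a
sharper bound for the digits than the circumradius), and every ring element below the
inradius is a power of \<open>\<tau>\<close> times a digit (\<open>short_is_digit\<close>), or 0.

It remains to see that the digits represent every residue class prime to \<open>\<tau>\<close> exactly once,
that is, that translates of the restricted Voronoi cell cover the relevant points without
overlap. No digit lies at a vertex or a midpoint of a side of \<open>\<tau> ^ w * V\<close>, since
an element of the ring at such a point is divisible by \<open>\<tau>\<close>
(\<open>quotient_coords_not_half_integral\<close>). What is left of the restricted cell is the
open hexagon with one open half of each side, and opposite halves are translates of
complementary ones (\<open>half_open_hexagon_disjoint\<close>, \<open>half_open_hexagon_covers\<close>).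
\<close>

section \<open>Optimality from merging pairs of digits\<close>

definition shift_exponents :: "nat \<Rightarrow> (complex \<times> nat) multiset \<Rightarrow> (complex \<times> nat) multiset" where
  "shift_exponents i M = image_mset (\<lambda>(d, n). (d, n + i)) M"

lemma size_shift_exponents [simp]: "size (shift_exponents i M) = size M"
  by (simp add: shift_exponents_def)

lemma is_multi_expansion_shift:
  assumes "is_multi_expansion \<tau> D z M"
  shows "is_multi_expansion \<tau> D (\<tau> ^ i * z) (shift_exponents i M)"
  using assms unfolding is_multi_expansion_def shift_exponents_def
  by (auto simp: sum_mset_distrib_left image_mset.compositionality o_def split_def power_add
        algebra_simps)

lemma is_multi_expansion_unshift:
  assumes "is_multi_expansion \<tau> D z M" and ge: "\<And>d n. (d, n) \<in># M \<Longrightarrow> i \<le> n"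
  obtains z' M' where "is_multi_expansion \<tau> D z' M'" "z = \<tau> ^ i * z'" "size M' = size M"
proof
  let ?M' = "image_mset (\<lambda>(d, n). (d, n - i)) M"
  let ?z' = "\<Sum>(d, n)\<in>#?M'. d * \<tau> ^ n"
  show "is_multi_expansion \<tau> D ?z' ?M'"
    using assms(1) by (auto simp: is_multi_expansion_def)
  have "\<tau> ^ i * ?z' = (\<Sum>(d, n)\<in>#M. \<tau> ^ i * (d * \<tau> ^ (n - i)))"
    by (simp add: sum_mset_distrib_left image_mset.compositionality o_def split_def)
  also have "\<dots> = (\<Sum>(d, n)\<in>#M. d * \<tau> ^ n)"
  proof (rule arg_cong[where f = sum_mset], rule image_mset_cong, clarify)
    fix d n assume "(d, n) \<in># M"
    then have "i + (n - i) = n" using ge by fastforce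
    then show "\<tau> ^ i * (d * \<tau> ^ (n - i)) = d * \<tau> ^ n"
      by (metis mult.left_commute power_add)
  qed
  finally show "z = \<tau> ^ i * ?z'"
    using assms(1) by (simp add: is_multi_expansion_def)
qed simp

lemma is_multi_expansion_add:
  assumes "is_multi_expansion \<tau> D y M" "is_multi_expansion \<tau> D z N"
  shows "is_multi_expansion \<tau> D (y + z) (M + N)"
  using assms by (auto simp: is_multi_expansion_def)

lemma is_multi_expansion_diff:
  assumes "is_multi_expansion \<tau> D (y + z) (M + N)" "is_multi_expansion \<tau> D y M"
  shows "is_multi_expansion \<tau> D z N"
  using assms by (auto simp: is_multi_expansion_def)

text \<open>A condition on digits that forces every \<open>w\<close>-NAF to be optimal. Its essential assumption is the last one: a
digit plus a digit shifted by fewer than \<open>w\<close> places can be rewritten, without using more terms,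
so that at most one term is left among the lowest \<open>w\<close> places.\<close>

locale digit_system =
  fixes \<tau> :: complex and R D :: "complex set" and w :: nat
  assumes w_pos: "0 < w"
    and base_nonzero: "\<tau> \<noteq> 0"
    and base_in: "\<tau> \<in> R"
    and zero_in: "0 \<in> R"
    and add_closed: "\<And>x y. x \<in> R \<Longrightarrow> y \<in> R \<Longrightarrow> x + y \<in> R"
    and diff_closed: "\<And>x y. x \<in> R \<Longrightarrow> y \<in> R \<Longrightarrow> x - y \<in> R"
    and mult_closed: "\<And>x y. x \<in> R \<Longrightarrow> y \<in> R \<Longrightarrow> x * y \<in> R"
    and digits_in: "D \<subseteq> R"
    and digit_not_dvd: "\<And>d. d \<in> D - {0} \<Longrightarrow> \<not> dvd_in R \<tau> d"
    and digit_unique: "\<And>c d. c \<in> D - {0} \<Longrightarrow> d \<in> D - {0} \<Longrightarrow> dvd_in R (\<tau> ^ w) (c - d) \<Longrightarrow> c = d"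
    and merge: "\<And>c d k. c \<in> D - {0} \<Longrightarrow> d \<in> D - {0} \<Longrightarrow> k < w \<Longrightarrow>
      \<exists>N. is_multi_expansion \<tau> D (c + \<tau> ^ k * d) N \<and> size N \<le> 2
        \<and> size {#x \<in># N. snd x < w#} \<le> 1"
begin

lemma multi_expansion_in:
  assumes "is_multi_expansion \<tau> D z M"
  shows "z \<in> R"
proof -
  have pow: "d * \<tau> ^ n \<in> R" if "d \<in> D" for d n
    using that digits_in base_in
    by (induction n) (auto intro: mult_closed simp: mult.left_commute)
  have "(\<Sum>(d, n)\<in>#M. d * \<tau> ^ n) \<in> R" if "set_mset M \<subseteq> D \<times> UNIV"
    using that by (induction M) (auto intro: zero_in add_closed pow)
  then show ?thesis
    using assms by (auto simp: is_multi_expansion_def)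
qed

text \<open>Two terms among the lowest \<open>w\<close> places are a shifted instance of the merging assumption, and
each merge removes at least one of them: whatever else it produces lies at place \<open>w\<close> or above,
and shifting only moves terms further up. So merging terminates without any measure of size on
the ring.\<close>

lemma thin_multi_expansion:
  assumes "is_multi_expansion \<tau> D z M"
  shows "\<exists>M'. is_multi_expansion \<tau> D z M' \<and> size M' \<le> size M
           \<and> size {#x \<in># M'. snd x < w#} \<le> 1"
  using assms
proof (induction "size {#x \<in># M. snd x < w#}" arbitrary: M rule: less_induct)
  case less
  let ?low = "\<lambda>M :: (complex \<times> nat) multiset. {#x \<in># M. snd x < w#}"
  show ?case
  proof (cases "size (?low M) \<le> 1")
    case True
    then show ?thesis using less.prems by blast
  next
    case False
    then obtain x K where x: "?low M = add_mset x K"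
      by (metis multiset_cases size_empty zero_le)
    with False obtain y L where y: "K = add_mset y L"
      by (metis One_nat_def le_refl multiset_cases size_add_mset size_empty)
    have "\<exists>c d i k L. ?low M = {#(c, i), (d, i + k)#} + L"
    proof (cases "snd x \<le> snd y")
      case True
      then have "?low M = {#(fst x, snd x), (fst y, snd x + (snd y - snd x))#} + L"
        using x y by simp
      then show ?thesis by blast
    next
      case False
      then have "?low M = {#(fst y, snd y), (fst x, snd y + (snd x - snd y))#} + L"
        using x y by simp
      then show ?thesis by blast
    qed
    then obtain c d i k L where low: "?low M = {#(c, i), (d, i + k)#} + L"
      by blast
    define M0 where "M0 = L + {#x \<in># M. \<not> snd x < w#}"
    have M: "M = {#(c, i), (d, i + k)#} + M0"
      unfolding M0_def using multiset_partition[of M "\<lambda>x. snd x < w"] low by simp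
    have "(d, i + k) \<in># ?low M" by (simp add: low)
    then have lt: "i + k < w" by simp
    have dig: "c \<in> D - {0}" "d \<in> D - {0}"
      using less.prems M by (auto simp: is_multi_expansion_def)
    obtain N where N: "is_multi_expansion \<tau> D (c + \<tau> ^ k * d) N" "size N \<le> 2"
      "size (?low N) \<le> 1"
      using merge[OF dig, of k] lt by auto
    define M1 where "M1 = shift_exponents i N + M0"
    define s where "s = c * \<tau> ^ i + d * \<tau> ^ (i + k)"
    have "is_multi_expansion \<tau> D s {#(c, i), (d, i + k)#}"
      using dig by (simp add: is_multi_expansion_def s_def)
    then have "is_multi_expansion \<tau> D (z - s) M0"
      using less.prems M is_multi_expansion_diff[of \<tau> D s "z - s" "{#(c, i), (d, i + k)#}" M0] by simp
    moreover have "s = \<tau> ^ i * (c + \<tau> ^ k * d)"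
      by (simp add: s_def algebra_simps power_add)
    ultimately have M1: "is_multi_expansion \<tau> D z M1"
      using is_multi_expansion_add[OF is_multi_expansion_shift[OF N(1), of i]]
      by (metis M1_def add_diff_cancel_left' diff_add_cancel add.commute)
    have "size (?low (shift_exponents i N)) \<le> size (?low N)"
      unfolding shift_exponents_def filter_mset_image_mset size_image_mset
      by (intro size_mset_mono filter_mset_mono_strong) auto
    moreover have "size (?low M) = 2 + size (?low M0)"
      using lt by (simp add: M)
    ultimately have "size (?low M1) < size (?low M)"
      using N(3) by (simp add: M1_def)
    from less.hyps[OF this M1] obtain M' where
      "is_multi_expansion \<tau> D z M'" "size M' \<le> size M1" "size (?low M') \<le> 1" by blast
    moreover have "size M1 \<le> size M"
      using N(2) by (simp add: M M1_def)
    ultimately show ?thesis by fastforce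
  qed
qed

text \<open>Cutting off the lowest digit together with a run of zeros above it; used with \<open>k = 1\<close>, where
the run is empty, and with \<open>k = w\<close>, where the non-adjacency supplies it.\<close>

lemma expansion_split:
  assumes exp: "is_expansion \<tau> D z \<eta>" and k: "0 < k"
    and gap: "\<And>i. 0 < i \<Longrightarrow> i < k \<Longrightarrow> \<eta> i = 0"
  obtains y where "is_expansion \<tau> D y (\<lambda>n. \<eta> (n + k))" "y \<in> R" "z = \<eta> 0 + \<tau> ^ k * y"
    "expansion_weight \<eta> = (if \<eta> 0 = 0 then 0 else 1) + expansion_weight (\<lambda>n. \<eta> (n + k))"
proof
  let ?S = "{n. \<eta> (n + k) \<noteq> 0}"
  let ?I = "(\<lambda>n. n + k) ` ?S"
  let ?Z = "if \<eta> 0 = 0 then {} else {0 :: nat}"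
  let ?y = "\<Sum>n\<in>?S. \<eta> (n + k) * \<tau> ^ n"
  have supp: "{n. \<eta> n \<noteq> 0} = ?Z \<union> ?I"
  proof (intro equalityI subsetI)
    fix n assume "n \<in> {n. \<eta> n \<noteq> 0}"
    then have n: "\<eta> n \<noteq> 0" by simp
    show "n \<in> ?Z \<union> ?I"
    proof (cases "n < k")
      case True
      then show ?thesis using n gap[of n] by auto
    next
      case False
      then have "n = (n - k) + k" by simp
      then show ?thesis using n by (metis (mono_tags, lifting) UnI2 imageI mem_Collect_eq)
    qed
  qed (auto split: if_splits)
  have fin: "finite ?I"
    using exp supp unfolding is_expansion_def by (metis finite_Un)
  then have finS: "finite ?S"
    by (rule finite_imageD) (auto intro: inj_onI)
  have disj: "?Z \<inter> ?I = {}" using k by auto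
  have inj: "inj_on (\<lambda>n. n + k) ?S" by (auto intro: inj_onI)
  show exp': "is_expansion \<tau> D ?y (\<lambda>n. \<eta> (n + k))"
    using exp finS by (simp add: is_expansion_def)
  have pow: "d * \<tau> ^ n \<in> R" if "d \<in> D" for d n
    using that digits_in base_in
    by (induction n) (auto intro: mult_closed simp: mult.left_commute)
  have "(\<Sum>n\<in>S. \<eta> (n + k) * \<tau> ^ n) \<in> R" for S
    using exp
    by (induction S rule: infinite_finite_induct)
       (auto simp: is_expansion_def intro!: zero_in add_closed pow)
  then show "?y \<in> R" .
  have "z = (\<Sum>n\<in>?Z. \<eta> n * \<tau> ^ n) + (\<Sum>n\<in>?I. \<eta> n * \<tau> ^ n)"
    using exp fin disj unfolding is_expansion_def supp by (subst sum.union_disjoint[symmetric]) auto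
  also have "(\<Sum>n\<in>?I. \<eta> n * \<tau> ^ n) = \<tau> ^ k * ?y"
    by (subst sum.reindex[OF inj]) (simp add: sum_distrib_left power_add algebra_simps)
  finally show "z = \<eta> 0 + \<tau> ^ k * ?y" by auto
  show "expansion_weight \<eta> = (if \<eta> 0 = 0 then 0 else 1) + expansion_weight (\<lambda>n. \<eta> (n + k))"
    unfolding expansion_weight_def supp using fin disj
    by (subst card_Un_disjoint) (auto simp: card_image[OF inj])
qed

lemma wNAF_shift:
  assumes "is_wNAF_expansion \<tau> w D z \<eta>" "is_expansion \<tau> D y (\<lambda>n. \<eta> (n + k))"
  shows "is_wNAF_expansion \<tau> w D y (\<lambda>n. \<eta> (n + k))"
  unfolding is_wNAF_expansion_def
proof (intro conjI allI)
  fix j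
  have "(\<lambda>n. n + k) ` {n \<in> {j..<j + w}. \<eta> (n + k) \<noteq> 0} = {n \<in> {j + k..<j + k + w}. \<eta> n \<noteq> 0}"
    (is "?f ` ?A = ?B")
  proof (intro equalityI subsetI)
    fix n assume n: "n \<in> ?B"
    then have "n = (n - k) + k" by simp
    moreover from n have "n - k \<in> ?A" by auto
    ultimately show "n \<in> ?f ` ?A" by blast
  qed auto
  then have "card ?A = card ?B"
    by (metis (no_types, lifting) card_image inj_on_def add_right_cancel)
  then show "card ?A \<le> 1"
    using assms(1) by (simp add: is_wNAF_expansion_def)
qed (fact assms(2))

lemma wNAF_gap:
  assumes "is_wNAF_expansion \<tau> w D z \<eta>" "\<eta> 0 \<noteq> 0" "0 < i" "i < w"
  shows "\<eta> i = 0"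
proof (rule ccontr)
  assume "\<eta> i \<noteq> 0"
  then have "{0, i} \<subseteq> {n \<in> {0..<0 + w}. \<eta> n \<noteq> 0}" using assms by auto
  then have "card {0, i} \<le> card {n \<in> {0..<0 + w}. \<eta> n \<noteq> 0}" by (intro card_mono) auto
  also have "\<dots> \<le> 1" using assms(1) unfolding is_wNAF_expansion_def by blast
  finally show False using \<open>0 < i\<close> by simp
qed

lemma dvd_in_pow_mult:
  assumes x: "x \<in> R" and "0 < k"
  shows "dvd_in R \<tau> (\<tau> ^ k * x)"
proof -
  obtain j where j: "k = Suc j" using \<open>0 < k\<close> by (metis gr0_implies_Suc)
  have "\<tau> ^ j * x \<in> R" using x base_in
    by (induction j) (auto intro: mult_closed simp: mult.assoc)
  then show ?thesis unfolding dvd_in_def j by (auto simp: mult.assoc)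
qed

text \<open>Induction on the length of the \<open>w\<close>-NAF. After thinning, the competing multi-expansion has
either no term at place 0, so that both sides are divisible by \<open>\<tau>\<close>, or exactly one, whose
digit is then congruent to the value modulo \<open>\<tau> ^ w\<close> and hence equal to the lowest digit of the
\<open>w\<close>-NAF. In the first case both expansions are divided by \<open>\<tau>\<close>; in the second the
common digit is removed and both are divided by \<open>\<tau> ^ w\<close>.\<close>

lemma wNAF_weight_le:
  assumes "is_wNAF_expansion \<tau> w D z \<eta>" "is_multi_expansion \<tau> D z M" "\<And>n. N \<le> n \<Longrightarrow> \<eta> n = 0"
  shows "expansion_weight \<eta> \<le> size M"
  using assms
proof (induction N arbitrary: z \<eta> M)
  case 0
  then show ?case by (simp add: expansion_weight_def)
next
  case (Suc N)
  have exp: "is_expansion \<tau> D z \<eta>"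
    using Suc.prems(1) by (simp add: is_wNAF_expansion_def)
  have digit: "\<eta> 0 \<in> D" using exp by (simp add: is_expansion_def)
  obtain M' where M': "is_multi_expansion \<tau> D z M'" "size M' \<le> size M"
    "size {#x \<in># M'. snd x < w#} \<le> 1"
    using thin_multi_expansion[OF Suc.prems(2)] by blast
  show ?case
  proof (cases "\<exists>d. (d, 0) \<in># M'")
    case False
    then have "1 \<le> n" if "(d, n) \<in># M'" for d n
      using that by (cases n) auto
    then obtain z' M'' where z': "is_multi_expansion \<tau> D z' M''" "z = \<tau> ^ 1 * z'"
        and size: "size M'' = size M'"
      using is_multi_expansion_unshift[OF M'(1), of 1] by blast
    obtain y where y: "is_expansion \<tau> D y (\<lambda>n. \<eta> (n + 1))" "y \<in> R" "z = \<eta> 0 + \<tau> ^ 1 * y"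
      and wt: "expansion_weight \<eta> = (if \<eta> 0 = 0 then 0 else 1) + expansion_weight (\<lambda>n. \<eta> (n + 1))"
      using expansion_split[OF exp, of 1] by auto
    have "\<eta> 0 = \<tau> * (z' - y)"
      using z'(2) y(3) by (simp add: algebra_simps)
    then have "dvd_in R \<tau> (\<eta> 0)"
      using multi_expansion_in[OF z'(1)] y(2) diff_closed by (auto simp: dvd_in_def)
    then have zero: "\<eta> 0 = 0" using digit digit_not_dvd by blast
    then have "y = z'" using z'(2) y(3) base_nonzero by simp
    then have "expansion_weight (\<lambda>n. \<eta> (n + 1)) \<le> size M''"
      using Suc.IH[OF wNAF_shift[OF Suc.prems(1) y(1)]] z'(1) Suc.prems(3) by simp
    then show ?thesis using wt zero size M'(2) by simp
  next
    case True
    then obtain d L where L: "M' = add_mset (d, 0) L"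
      by (metis insert_DiffM)
    have d: "d \<in> D - {0}" using M'(1) L by (auto simp: is_multi_expansion_def)
    have "is_multi_expansion \<tau> D d {#(d, 0)#}"
      using d by (simp add: is_multi_expansion_def)
    then have mL: "is_multi_expansion \<tau> D (z - d) L"
      using M'(1) L is_multi_expansion_diff[of \<tau> D d "z - d" "{#(d, 0)#}" L] by simp
    have low: "{#x \<in># L. snd x < w#} = {#}" using M'(3) L w_pos by simp
    have "w \<le> n" if "(e, n) \<in># L" for e n
    proof (rule ccontr)
      assume "\<not> w \<le> n"
      with that have "(e, n) \<in># {#x \<in># L. snd x < w#}" by simp
      then show False by (simp add: low)
    qed
    then obtain z' M'' where z': "is_multi_expansion \<tau> D z' M''" "z - d = \<tau> ^ w * z'"
        and size: "size M'' = size L"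
      using is_multi_expansion_unshift[OF mL, of w] by blast
    have z'R: "z' \<in> R" using multi_expansion_in[OF z'(1)] .
    have nz: "\<eta> 0 \<noteq> 0"
    proof
      assume zero: "\<eta> 0 = 0"
      obtain y where y: "y \<in> R" "z = \<eta> 0 + \<tau> ^ 1 * y"
        using expansion_split[OF exp, of 1] by auto
      obtain v where v: "v \<in> R" "\<tau> ^ w * z' = \<tau> * v"
        using dvd_in_pow_mult[OF z'R w_pos] by (auto simp: dvd_in_def)
      have "d = \<tau> * (y - v)" using zero y(2) z'(2) v(2) by (simp add: algebra_simps)
      then have "dvd_in R \<tau> d" using y(1) v(1) diff_closed by (auto simp: dvd_in_def)
      then show False using d digit_not_dvd by blast
    qed
    obtain y where y: "is_expansion \<tau> D y (\<lambda>n. \<eta> (n + w))" "y \<in> R" "z = \<eta> 0 + \<tau> ^ w * y"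
      and wt: "expansion_weight \<eta> = (if \<eta> 0 = 0 then 0 else 1) + expansion_weight (\<lambda>n. \<eta> (n + w))"
      using expansion_split[OF exp w_pos wNAF_gap[OF Suc.prems(1) nz]] by blast
    have "\<eta> 0 - d = \<tau> ^ w * (z' - y)"
      using y(3) z'(2) by (simp add: algebra_simps)
    then have "dvd_in R (\<tau> ^ w) (\<eta> 0 - d)"
      using y(2) z'R diff_closed by (auto simp: dvd_in_def)
    then have "\<eta> 0 = d" using digit_unique digit nz d by blast
    then have "y = z'" using y(3) z'(2) base_nonzero by (simp add: algebra_simps)
    then have "expansion_weight (\<lambda>n. \<eta> (n + w)) \<le> size M''"
      using Suc.IH[OF wNAF_shift[OF Suc.prems(1) y(1)]] z'(1) Suc.prems(3) w_pos by simp
    then show ?thesis using wt nz size M'(2) L by simp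
  qed
qed

theorem wNAF_optimal:
  assumes "is_wNAF_expansion \<tau> w D z \<eta>"
  shows "is_optimal_expansion \<tau> D z \<eta>"
proof -
  have exp: "is_expansion \<tau> D z \<eta>" using assms by (simp add: is_wNAF_expansion_def)
  then have "finite {n. \<eta> n \<noteq> 0}" by (simp add: is_expansion_def)
  then obtain N where "\<forall>n\<in>{n. \<eta> n \<noteq> 0}. n < N" using finite_nat_bounded by blast
  then have "\<eta> n = 0" if "N \<le> n" for n using that by fastforce
  with exp show ?thesis
    using wNAF_weight_le[OF assms] unfolding is_optimal_expansion_def by blast
qed

end

section \<open>Tiling the plane by half-open hexagons\<close>

text \<open>Coordinates: a plane point \<open>z\<close> is given by the two real numbers \<open>x\<close>, \<open>y\<close> that are twice its
inner products with the generators \<open>1\<close> and \<open>\<zeta>\<close> of the hexagonal lattice, where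
\<open>\<zeta>\<^sup>2 = \<zeta> - 1\<close>. The lattice point \<open>m + n\<zeta>\<close> has coordinates \<open>(2m + n, m + 2n)\<close>, and the six
units \<open>\<plusminus>1\<close>, \<open>\<plusminus>\<zeta>\<close>, \<open>\<plusminus>(\<zeta> - 1)\<close> give the conditions that bound the Voronoi cell. The
advantage over Cartesian coordinates is that no root of 3 and no sign of the imaginary part
appears.\<close>

definition hexagon :: "real \<Rightarrow> real \<Rightarrow> bool" where
  "hexagon x y \<longleftrightarrow> \<bar>x\<bar> \<le> 1 \<and> \<bar>y\<bar> \<le> 1 \<and> \<bar>x - y\<bar> \<le> 1"

text \<open>The restricted Voronoi cell without the vertices and the midpoints of the sides: of each
side only the open half next to its later vertex, in the cyclic order, is retained. Translation by a unit carries
a side to the opposite one and exchanges the two kinds of halves.\<close>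

definition half_open_hexagon :: "real \<Rightarrow> real \<Rightarrow> bool" where
  "half_open_hexagon x y \<longleftrightarrow> hexagon x y
     \<and> (x = 1 \<longrightarrow> 1/2 < y \<and> y < 1) \<and> (y = 1 \<longrightarrow> 1/2 < y - x \<and> y - x < 1)
     \<and> (y - x = 1 \<longrightarrow> 1/2 < - x \<and> - x < 1) \<and> (x = - 1 \<longrightarrow> 1/2 < - y \<and> - y < 1)
     \<and> (y = - 1 \<longrightarrow> 1/2 < x - y \<and> x - y < 1) \<and> (x - y = 1 \<longrightarrow> 1/2 < x \<and> x < 1)"

lemma add_le_quadratic:
  fixes i j :: int
  assumes "0 \<le> i" "0 \<le> j"
  shows "i + j \<le> i\<^sup>2 + i * j + j\<^sup>2"
    and "i + j = i\<^sup>2 + i * j + j\<^sup>2 \<Longrightarrow> i = 0 \<and> j = 0 \<or> i = 1 \<and> j = 0 \<or> i = 0 \<and> j = 1"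
proof -
  have sq: "k \<le> k\<^sup>2" if "0 \<le> k" for k :: int
    using that by (cases "k = 0") (auto simp: power2_eq_square)
  have p: "0 \<le> i * j" using assms by simp
  show "i + j \<le> i\<^sup>2 + i * j + j\<^sup>2"
    using sq[OF assms(1)] sq[OF assms(2)] p by linarith
  assume "i + j = i\<^sup>2 + i * j + j\<^sup>2"
  then have "i = i\<^sup>2" "j = j\<^sup>2" "i * j = 0"
    using sq[OF assms(1)] sq[OF assms(2)] p by linarith+
  then show "i = 0 \<and> j = 0 \<or> i = 1 \<and> j = 0 \<or> i = 0 \<and> j = 1"
    by (auto simp: power2_eq_square)
qed

text \<open>A lattice point in the sector spanned by two neighbouring units is \<open>i\<close> times the one plus
\<open>j\<close> times the other with \<open>i, j \<ge> 0\<close>, and its squared norm is \<open>i\<^sup>2 + ij + j\<^sup>2\<close>. Hence the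
half-plane conditions of these two units imply the one of the lattice point, strictly unless it
is 0 or one of the two units.\<close>

lemma sector_bound:
  fixes i j :: int and a b :: real
  assumes "0 \<le> i" "0 \<le> j" "a \<le> 1" "b \<le> 1"
  shows "i * a + j * b \<le> of_int (i\<^sup>2 + i * j + j\<^sup>2)"
    and "i * a + j * b = of_int (i\<^sup>2 + i * j + j\<^sup>2) \<Longrightarrow>
      i = 0 \<and> j = 0 \<or> i = 1 \<and> j = 0 \<and> a = 1 \<or> i = 0 \<and> j = 1 \<and> b = 1"
proof -
  have 1: "i * a \<le> i" "j * b \<le> j" using assms by (simp_all add: mult_left_le)
  have 2: "real_of_int (i + j) \<le> of_int (i\<^sup>2 + i * j + j\<^sup>2)"
    unfolding of_int_le_iff by (rule add_le_quadratic[OF assms(1,2)])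
  then show "i * a + j * b \<le> of_int (i\<^sup>2 + i * j + j\<^sup>2)" using 1 by simp
  assume eq: "i * a + j * b = of_int (i\<^sup>2 + i * j + j\<^sup>2)"
  then have "real_of_int (i + j) = of_int (i\<^sup>2 + i * j + j\<^sup>2)" using 1 2 by simp
  then have "i + j = i\<^sup>2 + i * j + j\<^sup>2" unfolding of_int_eq_iff .
  from add_le_quadratic(2)[OF assms(1,2) this] eq
  show "i = 0 \<and> j = 0 \<or> i = 1 \<and> j = 0 \<and> a = 1 \<or> i = 0 \<and> j = 1 \<and> b = 1" by auto
qed

text \<open>The left-hand side is twice the inner product with \<open>m + n\<zeta>\<close> and the right-hand side is the
squared norm of \<open>m + n\<zeta>\<close>, so this says that no lattice point is closer than 0, and that only
units can be equally close. The six cases are the six sectors between neighbouring units.\<close>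

lemma hexagon_lattice:
  fixes m n :: int and x y :: real
  assumes "hexagon x y"
  shows "m * x + n * y \<le> of_int (m\<^sup>2 + m * n + n\<^sup>2)"
    and "m * x + n * y = of_int (m\<^sup>2 + m * n + n\<^sup>2) \<Longrightarrow>
      (m, n) = (0, 0) \<or> (m, n) = (1, 0) \<and> x = 1 \<or> (m, n) = (0, 1) \<and> y = 1
      \<or> (m, n) = (-1, 1) \<and> y - x = 1 \<or> (m, n) = (-1, 0) \<and> x = -1
      \<or> (m, n) = (0, -1) \<and> y = -1 \<or> (m, n) = (1, -1) \<and> x - y = 1"
proof -
  have h: "x \<le> 1" "-x \<le> 1" "y \<le> 1" "-y \<le> 1" "x - y \<le> 1" "y - x \<le> 1"
    using assms by (auto simp: hexagon_def abs_le_iff)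
  let ?Q = "(m, n) = (0, 0) \<or> (m, n) = (1, 0) \<and> x = 1 \<or> (m, n) = (0, 1) \<and> y = 1
      \<or> (m, n) = (-1, 1) \<and> y - x = 1 \<or> (m, n) = (-1, 0) \<and> x = -1
      \<or> (m, n) = (0, -1) \<and> y = -1 \<or> (m, n) = (1, -1) \<and> x - y = 1"
  have sector: "m * x + n * y \<le> of_int (m\<^sup>2 + m * n + n\<^sup>2) \<and>
      (m * x + n * y = of_int (m\<^sup>2 + m * n + n\<^sup>2) \<longrightarrow> ?Q)"
    if "0 \<le> i" "0 \<le> j" "a \<le> 1" "b \<le> 1" and "m * x + n * y = i * a + j * b"
      and "m\<^sup>2 + m * n + n\<^sup>2 = i\<^sup>2 + i * j + j\<^sup>2"
      and "i = 0 \<and> j = 0 \<Longrightarrow> ?Q" "i = 1 \<and> j = 0 \<and> a = 1 \<Longrightarrow> ?Q"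
        "i = 0 \<and> j = 1 \<and> b = 1 \<Longrightarrow> ?Q"
    for i j :: int and a b :: real
    using sector_bound[OF that(1-4)] that(5-) by metis
  consider "0 \<le> m" "0 \<le> n" | "m \<le> 0" "0 \<le> m + n" | "0 \<le> n" "m + n \<le> 0"
    | "m \<le> 0" "n \<le> 0" | "0 \<le> m" "m + n \<le> 0" | "n \<le> 0" "0 \<le> m + n" by linarith
  then have *: "m * x + n * y \<le> of_int (m\<^sup>2 + m * n + n\<^sup>2) \<and>
      (m * x + n * y = of_int (m\<^sup>2 + m * n + n\<^sup>2) \<longrightarrow> ?Q)"
  proof cases
    case 1
    then show ?thesis using h
      by (intro sector[of "m" "n" "x" "y"]) (auto simp: algebra_simps power2_eq_square)
  next
    case 2
    then show ?thesis using h
      by (intro sector[of "m + n" "- m" "y" "y - x"]) (auto simp: algebra_simps power2_eq_square)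
  next
    case 3
    then show ?thesis using h
      by (intro sector[of "n" "- m - n" "y - x" "- x"]) (auto simp: algebra_simps power2_eq_square)
  next
    case 4
    then show ?thesis using h
      by (intro sector[of "- m" "- n" "- x" "- y"]) (auto simp: algebra_simps power2_eq_square)
  next
    case 5
    then show ?thesis using h
      by (intro sector[of "- m - n" "m" "- y" "x - y"]) (auto simp: algebra_simps power2_eq_square)
  next
    case 6
    then show ?thesis using h
      by (intro sector[of "- n" "m + n" "x - y" "x"]) (auto simp: algebra_simps power2_eq_square)
  qed
  from * show "m * x + n * y \<le> of_int (m\<^sup>2 + m * n + n\<^sup>2)" ..
  assume "m * x + n * y = of_int (m\<^sup>2 + m * n + n\<^sup>2)"
  with * show "(m, n) = (0, 0) \<or> (m, n) = (1, 0) \<and> x = 1 \<or> (m, n) = (0, 1) \<and> y = 1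
      \<or> (m, n) = (-1, 1) \<and> y - x = 1 \<or> (m, n) = (-1, 0) \<and> x = -1
      \<or> (m, n) = (0, -1) \<and> y = -1 \<or> (m, n) = (1, -1) \<and> x - y = 1" by blast
qed

text \<open>A common point of two translates is equally close to both centres, so these differ by a unit
and the point lies on opposite sides of the two cells, in halves that do not match.\<close>

lemma half_open_hexagon_disjoint:
  fixes m n :: int and x y :: real
  assumes "half_open_hexagon x y" "half_open_hexagon (x - of_int (2 * m + n)) (y - of_int (m + 2 * n))"
  shows "m = 0 \<and> n = 0"
proof -
  have h: "hexagon x y" "hexagon (x - of_int (2 * m + n)) (y - of_int (m + 2 * n))"
    using assms by (auto simp: half_open_hexagon_def)
  have "(-m) * (x - of_int (2 * m + n)) + (-n) * (y - of_int (m + 2 * n)) \<le> of_int ((-m)\<^sup>2 + (-m) * (-n) + (-n)\<^sup>2)"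
    using hexagon_lattice(1)[OF h(2), of "-m" "-n"] by simp
  then have "real_of_int (m\<^sup>2 + m * n + n\<^sup>2) \<le> m * x + n * y"
    by (simp add: algebra_simps power2_eq_square)
  then have "m * x + n * y = of_int (m\<^sup>2 + m * n + n\<^sup>2)"
    using hexagon_lattice(1)[OF h(1), of m n] by linarith
  note unit = hexagon_lattice(2)[OF h(1) this]
  have edge: "(u = 1 \<longrightarrow> 1/2 < v) \<and> (v = 1 \<longrightarrow> 1/2 < v - u) \<and> (v - u = 1 \<longrightarrow> 1/2 < - u)
      \<and> (u = - 1 \<longrightarrow> 1/2 < - v) \<and> (v = - 1 \<longrightarrow> 1/2 < u - v) \<and> (u - v = 1 \<longrightarrow> 1/2 < u)"
    if "half_open_hexagon u v" for u v
    using that unfolding half_open_hexagon_def by meson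
  from unit show ?thesis
    by (elim disjE) (use edge[OF assms(1)] edge[OF assms(2)] in simp_all)
qed

text \<open>Reduce to the fundamental parallelogram with corners \<open>0\<close>, \<open>1\<close>, \<open>\<zeta>\<close>, \<open>1 + \<zeta>\<close>; one of these
corners is a closest lattice point.\<close>

lemma hexagon_covers:
  fixes x y :: real
  shows "\<exists>m n :: int. hexagon (x - of_int (2 * m + n)) (y - of_int (m + 2 * n))"
proof -
  define a b where "a = frac ((2 * x - y) / 3)" and "b = frac ((2 * y - x) / 3)"
  define i j where "i = \<lfloor>(2 * x - y) / 3\<rfloor>" and "j = \<lfloor>(2 * y - x) / 3\<rfloor>"
  have ab: "0 \<le> a" "a < 1" "0 \<le> b" "b < 1"
    by (simp_all add: a_def b_def frac_ge_0 frac_lt_1)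
  have ij: "(2 * x - y) / 3 = i + a" "(2 * y - x) / 3 = j + b"
    by (simp_all add: a_def b_def i_def j_def frac_def)
  then have x: "x = of_int (2 * i + j) + (2 * a + b)" and y: "y = of_int (i + 2 * j) + (a + 2 * b)"
    by (simp_all add: field_simps)
  consider "2 * a + b \<le> 1" "a + 2 * b \<le> 1" | "b \<le> a" "1 \<le> 2 * a + b" "a + 2 * b \<le> 2"
    | "a \<le> b" "1 \<le> a + 2 * b" "2 * a + b \<le> 2" | "2 \<le> 2 * a + b" "2 \<le> a + 2 * b" by linarith
  then have "\<exists>m n :: int. hexagon (2 * a + b - of_int (2 * m + n)) (a + 2 * b - of_int (m + 2 * n))"
  proof cases
    case 1
    then show ?thesis using ab by (intro exI[of _ 0]) (auto simp: hexagon_def abs_le_iff)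
  next
    case 2
    then show ?thesis using ab
      by (intro exI[of _ 1] exI[of _ 0]) (auto simp: hexagon_def abs_le_iff)
  next
    case 3
    then show ?thesis using ab
      by (intro exI[of _ 0] exI[of _ 1]) (auto simp: hexagon_def abs_le_iff)
  next
    case 4
    then show ?thesis using ab
      by (intro exI[of _ 1] exI[of _ 1]) (auto simp: hexagon_def abs_le_iff)
  qed
  then obtain m n :: int where "hexagon (2 * a + b - of_int (2 * m + n)) (a + 2 * b - of_int (m + 2 * n))"
    by blast
  moreover have "2 * a + b - of_int (2 * m + n) = x - of_int (2 * (i + m) + (j + n))"
    "a + 2 * b - of_int (m + 2 * n) = y - of_int ((i + m) + 2 * (j + n))"
    unfolding x y by simp_all
  ultimately show ?thesis by metis
qed

text \<open>Vertices and midpoints of sides have half-integral coordinates. For any other point, a cell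
that contains it on an excluded half side is replaced by its neighbour across that side.\<close>

lemma half_open_hexagon_covers:
  fixes x y :: real
  assumes nondeg: "2 * x \<notin> \<int> \<or> 2 * y \<notin> \<int>"
  shows "\<exists>m n :: int. half_open_hexagon (x - of_int (2 * m + n)) (y - of_int (m + 2 * n))"
proof -
  obtain i j :: int where h: "hexagon (x - of_int (2 * i + j)) (y - of_int (i + 2 * j))"
    using hexagon_covers by blast
  define u v where "u = x - of_int (2 * i + j)" and "v = y - of_int (i + 2 * j)"
  have nd: "\<not> (2 * u \<in> \<int> \<and> 2 * v \<in> \<int>)"
  proof
    assume *: "2 * u \<in> \<int> \<and> 2 * v \<in> \<int>"
    have "2 * x = 2 * u + of_int (2 * (2 * i + j))" "2 * y = 2 * v + of_int (2 * (i + 2 * j))"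
      by (simp_all add: u_def v_def)
    then show False using * nondeg by (metis Ints_add Ints_of_int)
  qed
  have half: "\<not> (2 * u = of_int k \<and> 2 * v = of_int l)" for k l
    using nd by (metis Ints_of_int)
  have uv: "\<bar>u\<bar> \<le> 1" "\<bar>v\<bar> \<le> 1" "\<bar>u - v\<bar> \<le> 1" using h by (auto simp: hexagon_def u_def v_def)
  have *: "\<exists>m n :: int. half_open_hexagon (u - of_int (2 * m + n)) (v - of_int (m + 2 * n))"
  proof (cases "half_open_hexagon u v")
    case True
    then show ?thesis by (intro exI[of _ 0]) auto
  next
    case False
    then consider "u = 1" | "v = 1" | "v - u = 1" | "u = -1" | "v = -1" | "u - v = 1"
      using uv by (auto simp: half_open_hexagon_def hexagon_def)
    then show ?thesis
    proof cases
      case 1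
      then show ?thesis using False uv half[of 2 0] half[of 2 1] half[of 2 2]
        by (intro exI[of _ 1] exI[of _ 0])
          (auto simp: half_open_hexagon_def hexagon_def abs_le_iff)
    next
      case 2
      then show ?thesis using False uv half[of 0 2] half[of 1 2] half[of 2 2]
        by (intro exI[of _ 0] exI[of _ 1])
          (auto simp: half_open_hexagon_def hexagon_def abs_le_iff)
    next
      case 3
      then show ?thesis using False uv half[of 0 2] half[of "-1" 1] half[of "-2" 0]
        by (intro exI[of _ "-1"] exI[of _ 1])
          (auto simp: half_open_hexagon_def hexagon_def abs_le_iff)
    next
      case 4
      then show ?thesis using False uv half[of "-2" 0] half[of "-2" "-1"] half[of "-2" "-2"]
        by (intro exI[of _ "-1"] exI[of _ 0])
          (auto simp: half_open_hexagon_def hexagon_def abs_le_iff)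
    next
      case 5
      then show ?thesis using False uv half[of 0 "-2"] half[of "-1" "-2"] half[of "-2" "-2"]
        by (intro exI[of _ 0] exI[of _ "-1"])
          (auto simp: half_open_hexagon_def hexagon_def abs_le_iff)
    next
      case 6
      then show ?thesis using False uv half[of 0 "-2"] half[of 1 "-1"] half[of 2 0]
        by (intro exI[of _ 1] exI[of _ "-1"])
          (auto simp: half_open_hexagon_def hexagon_def abs_le_iff)
    qed
  qed
  then obtain m n :: int where "half_open_hexagon (u - of_int (2 * m + n)) (v - of_int (m + 2 * n))" by blast
  moreover have "u - of_int (2 * m + n) = x - of_int (2 * (i + m) + (j + n))"
    "v - of_int (m + 2 * n) = y - of_int ((i + m) + 2 * (j + n))"
    unfolding u_def v_def by simp_all
  ultimately show ?thesis by metis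
qed

lemma hexagon_quadratic_le:
  assumes "hexagon x y"
  shows "x\<^sup>2 - x * y + y\<^sup>2 \<le> 1"
proof -
  have h: "\<bar>x\<bar> \<le> 1" "\<bar>y\<bar> \<le> 1" "\<bar>x - y\<bar> \<le> 1" using assms by (auto simp: hexagon_def)
  have sq: "x\<^sup>2 \<le> 1" "y\<^sup>2 \<le> 1" "(x - y)\<^sup>2 \<le> 1"
    using h by (simp_all add: abs_square_le_1)
  \<comment> \<open>The form equals \<open>(x - y)\<^sup>2 + x y\<close>, \<open>x\<^sup>2 - y (x - y)\<close> and \<open>y\<^sup>2 + x (x - y)\<close>; one of the
    three products has the sign that leaves a square as an upper bound.\<close>
  have "x * y \<le> 0 \<or> 0 \<le> x * (x - y) \<and> y * (x - y) \<ge> 0 \<or> x * (x - y) \<le> 0 \<and> y * (x - y) \<le> 0"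
    by (auto simp: mult_le_0_iff zero_le_mult_iff)
  then show ?thesis
    using sq by (auto simp: power2_eq_square algebra_simps)
qed

text \<open>The six half sides are listed in the cyclic order of the vertices of the Voronoi cell,
beginning with the side from \<open>(1, 1)\<close> to \<open>(0, 1)\<close>.\<close>

lemma half_open_hexagon_iff:
  "half_open_hexagon x y \<longleftrightarrow> (\<bar>x\<bar> < 1 \<and> \<bar>y\<bar> < 1 \<and> \<bar>x - y\<bar> < 1)
     \<or> (y = 1 \<and> 1/2 < y - x \<and> y - x < 1) \<or> (y - x = 1 \<and> 1/2 < - x \<and> - x < 1)
     \<or> (x = - 1 \<and> 1/2 < - y \<and> - y < 1) \<or> (y = - 1 \<and> 1/2 < x - y \<and> x - y < 1)
     \<or> (x - y = 1 \<and> 1/2 < x \<and> x < 1) \<or> (x = 1 \<and> 1/2 < y \<and> y < 1)" (is "?L \<longleftrightarrow> ?R")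
proof
  assume L: ?L
  then have "\<bar>x\<bar> \<le> 1" "\<bar>y\<bar> \<le> 1" "\<bar>x - y\<bar> \<le> 1"
    by (auto simp: half_open_hexagon_def hexagon_def)
  then consider "\<bar>x\<bar> < 1 \<and> \<bar>y\<bar> < 1 \<and> \<bar>x - y\<bar> < 1"
    | "y = 1" | "y - x = 1" | "x = - 1" | "y = - 1" | "x - y = 1" | "x = 1" by linarith
  then show ?R using L unfolding half_open_hexagon_def by cases simp_all
next
  assume ?R
  then show ?L
    by (elim disjE) (auto simp: half_open_hexagon_def hexagon_def abs_less_iff abs_le_iff)
qed

section \<open>The Voronoi cell of the Eisenstein integers\<close>

text \<open>Here \<open>\<zeta>\<close> is one of the two primitive sixth roots of unity, with either sign of the imaginary
part, and \<open>\<tau>\<close> differs from it by an integer. Then \<open>\<int>[\<tau>]\<close> is the ring of Eisenstein integers.\<close>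

locale eisenstein =
  fixes \<zeta> \<tau> :: complex and c :: int
  assumes zeta_square: "\<zeta>\<^sup>2 = \<zeta> - 1"
    and tau: "\<tau> = of_int c + \<zeta>"
begin

lemma Re_zeta: "Re \<zeta> = 1/2" and Im_zeta_square: "(Im \<zeta>)\<^sup>2 = 3/4"
proof -
  have re: "(Re \<zeta>)\<^sup>2 - (Im \<zeta>)\<^sup>2 = Re \<zeta> - 1"
    using arg_cong[OF zeta_square, of Re] by (simp add: power2_eq_square)
  have im: "2 * Re \<zeta> * Im \<zeta> = Im \<zeta>"
    using arg_cong[OF zeta_square, of Im] by (simp add: power2_eq_square)
  have "Im \<zeta> \<noteq> 0"
  proof
    assume "Im \<zeta> = 0"
    then have "(Re \<zeta> - 1/2)\<^sup>2 = - (3/4)"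
      using re by (simp add: power2_eq_square algebra_simps)
    then show False using zero_le_power2[of "Re \<zeta> - 1/2"] by linarith
  qed
  then show half: "Re \<zeta> = 1/2" using im by simp
  show "(Im \<zeta>)\<^sup>2 = 3/4" using re unfolding half by (simp add: power_divide)
qed

lemma Im_zeta_nonzero: "Im \<zeta> \<noteq> 0"
  using Im_zeta_square by auto

text \<open>Twice the inner products with \<open>1\<close> and with \<open>\<zeta>\<close>.\<close>

definition xc :: "complex \<Rightarrow> real" where "xc z = 2 * Re z"

definition yc :: "complex \<Rightarrow> real" where "yc z = Re z + 2 * Im \<zeta> * Im z"

definition lattice_point :: "int \<Rightarrow> int \<Rightarrow> complex" where
  "lattice_point m n = of_int m + of_int n * \<zeta>"

lemma xc_simps [simp]:
  "xc (y + z) = xc y + xc z" "xc (y - z) = xc y - xc z" "xc (- z) = - xc z"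
  "xc (of_real a * z) = a * xc z" "xc (lattice_point m n) = of_int (2 * m + n)"
  by (simp_all add: xc_def lattice_point_def Re_zeta)

lemma yc_lattice_point [simp]: "yc (lattice_point m n) = of_int (m + 2 * n)"
proof -
  have "yc (lattice_point m n) = m + n / 2 + 2 * n * (Im \<zeta>)\<^sup>2"
    by (simp add: yc_def lattice_point_def Re_zeta power2_eq_square)
  then show ?thesis by (simp add: Im_zeta_square)
qed

lemma yc_simps [simp]:
  "yc (y + z) = yc y + yc z" "yc (y - z) = yc y - yc z" "yc (- z) = - yc z"
  "yc (of_real a * z) = a * yc z"
  by (simp_all add: yc_def algebra_simps)

lemma eq_iff_coords: "y = z \<longleftrightarrow> xc y = xc z \<and> yc y = yc z"
  using Im_zeta_nonzero by (auto simp: complex_eq_iff xc_def yc_def)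

lemma norm_square_coords: "(norm z)\<^sup>2 = ((xc z)\<^sup>2 - xc z * yc z + (yc z)\<^sup>2) / 3"
proof -
  have "(xc z)\<^sup>2 - xc z * yc z + (yc z)\<^sup>2 = 3 * (Re z)\<^sup>2 + 4 * (Im \<zeta>)\<^sup>2 * (Im z)\<^sup>2"
    by (simp add: xc_def yc_def power2_eq_square algebra_simps)
  then show ?thesis by (simp add: Im_zeta_square cmod_power2)
qed

lemma norm_square_lattice_point: "(norm (lattice_point m n))\<^sup>2 = of_int (m\<^sup>2 + m * n + n\<^sup>2)"
  unfolding norm_square_coords by (simp add: power2_eq_square algebra_simps)

lemma int_adjoin_eq: "int_adjoin \<tau> = {lattice_point m n | m n. True}"
proof (intro equalityI subsetI)
  fix z assume "z \<in> int_adjoin \<tau>"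
  then obtain f :: "int poly" where "z = poly (map_poly of_int f) \<tau>"
    by (auto simp: int_adjoin_def)
  moreover have "\<exists>m n. poly (map_poly of_int f) \<tau> = lattice_point m n"
  proof (induction f)
    case 0
    show ?case by (intro exI[of _ 0]) (simp add: lattice_point_def)
  next
    case (pCons a f)
    then obtain m n where mn: "poly (map_poly of_int f) \<tau> = lattice_point m n" by blast
    have "poly (map_poly of_int (pCons a f)) \<tau>
        = of_int a + (of_int c + \<zeta>) * (of_int m + of_int n * \<zeta>)"
      using mn by (simp add: map_poly_pCons tau lattice_point_def)
    also have "\<dots> = of_int (a + c * m) + of_int (m + c * n) * \<zeta> + of_int n * \<zeta>\<^sup>2"
      by (simp add: algebra_simps power2_eq_square)
    also have "\<dots> = lattice_point (a + c * m - n) (m + c * n + n)"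
      by (simp add: zeta_square lattice_point_def algebra_simps)
    finally show ?case by blast
  qed
  ultimately show "z \<in> {lattice_point m n | m n. True}" by auto
next
  fix z assume "z \<in> {lattice_point m n | m n. True}"
  then obtain m n where z: "z = lattice_point m n" by auto
  have "z = poly (map_poly of_int [:m - n * c, n:]) \<tau>"
    by (simp add: z tau lattice_point_def map_poly_pCons algebra_simps)
  then show "z \<in> int_adjoin \<tau>" unfolding int_adjoin_def by blast
qed

lemma lattice_point_in: "lattice_point m n \<in> int_adjoin \<tau>"
  by (auto simp: int_adjoin_eq)

lemma lattice_pointE:
  assumes "z \<in> int_adjoin \<tau>"
  obtains m n where "z = lattice_point m n"
  using assms by (auto simp: int_adjoin_eq)

lemma lattice_point_mult:
  "lattice_point m n * lattice_point k l = lattice_point (m * k - n * l) (m * l + n * k + n * l)"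
proof -
  have "lattice_point m n * lattice_point k l
      = of_int (m * k) + of_int (m * l + n * k) * \<zeta> + of_int (n * l) * \<zeta>\<^sup>2"
    by (simp add: lattice_point_def algebra_simps power2_eq_square)
  then show ?thesis by (simp add: zeta_square lattice_point_def algebra_simps)
qed

lemma int_adjoin_closed:
  assumes "y \<in> int_adjoin \<tau>" "z \<in> int_adjoin \<tau>"
  shows "y + z \<in> int_adjoin \<tau>" "y - z \<in> int_adjoin \<tau>" "y * z \<in> int_adjoin \<tau>"
proof -
  obtain m n k l where yz: "y = lattice_point m n" "z = lattice_point k l"
    using assms by (auto elim!: lattice_pointE)
  have "y + z = lattice_point (m + k) (n + l)" "y - z = lattice_point (m - k) (n - l)"
    by (simp_all add: yz lattice_point_def algebra_simps)
  then show "y + z \<in> int_adjoin \<tau>" "y - z \<in> int_adjoin \<tau>"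
    by (simp_all add: lattice_point_in)
  show "y * z \<in> int_adjoin \<tau>" by (simp add: yz lattice_point_mult lattice_point_in)
qed

lemma of_int_in: "of_int m \<in> int_adjoin \<tau>"
  using lattice_point_in[of m 0] by (simp add: lattice_point_def)

lemma norm_le_lattice_iff:
  "norm z \<le> norm (z - lattice_point m n) \<longleftrightarrow> m * xc z + n * yc z \<le> of_int (m\<^sup>2 + m * n + n\<^sup>2)"
proof -
  have "norm z \<le> norm (z - lattice_point m n) \<longleftrightarrow> (norm z)\<^sup>2 \<le> (norm (z - lattice_point m n))\<^sup>2"
    by (simp add: power_mono_iff)
  also have "(norm (z - lattice_point m n))\<^sup>2 - (norm z)\<^sup>2
      = of_int (m\<^sup>2 + m * n + n\<^sup>2) - (m * xc z + n * yc z)"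
    unfolding norm_square_coords
    by (simp add: power2_eq_square algebra_simps diff_divide_distrib add_divide_distrib)
  then have "(norm z)\<^sup>2 \<le> (norm (z - lattice_point m n))\<^sup>2
      \<longleftrightarrow> m * xc z + n * yc z \<le> of_int (m\<^sup>2 + m * n + n\<^sup>2)" by linarith
  finally show ?thesis .
qed

lemma voronoi_cell_iff: "z \<in> voronoi_cell \<tau> \<longleftrightarrow> hexagon (xc z) (yc z)"
proof
  assume z: "z \<in> voronoi_cell \<tau>"
  have "m * xc z + n * yc z \<le> of_int (m\<^sup>2 + m * n + n\<^sup>2)" for m n
    unfolding norm_le_lattice_iff[symmetric]
    using z lattice_point_in[of m n] by (simp add: voronoi_cell_def)
  from this[of 1 0] this[of "-1" 0] this[of 0 1] this[of 0 "-1"] this[of 1 "-1"] this[of "-1" 1]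
  show "hexagon (xc z) (yc z)" by (simp add: hexagon_def abs_le_iff)
next
  assume "hexagon (xc z) (yc z)"
  then show "z \<in> voronoi_cell \<tau>"
    using hexagon_lattice(1) norm_le_lattice_iff by (auto simp: voronoi_cell_def int_adjoin_eq)
qed

text \<open>An interior point stays in the cell when it is stretched slightly away from 0, which makes
all its bounds strict.\<close>

lemma interior_voronoi_cell_iff:
  "z \<in> interior (voronoi_cell \<tau>) \<longleftrightarrow> \<bar>xc z\<bar> < 1 \<and> \<bar>yc z\<bar> < 1 \<and> \<bar>xc z - yc z\<bar> < 1"
proof
  assume "z \<in> interior (voronoi_cell \<tau>)"
  then obtain e where e: "0 < e" "ball z e \<subseteq> voronoi_cell \<tau>"
    by (auto simp: mem_interior)
  define s where "s = e / (norm z + 1)"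
  have s: "0 < s" using e(1) by (simp add: s_def add_nonneg_pos)
  have "s * norm z < e"
    using e(1) by (simp add: s_def divide_simps add_nonneg_pos)
  then have "z + of_real s * z \<in> ball z e"
    using s by (simp add: dist_norm norm_mult)
  then have "hexagon (xc (z + of_real s * z)) (yc (z + of_real s * z))"
    using e(2) voronoi_cell_iff by blast
  then have "\<bar>(1 + s) * xc z\<bar> \<le> 1 \<and> \<bar>(1 + s) * yc z\<bar> \<le> 1 \<and> \<bar>(1 + s) * (xc z - yc z)\<bar> \<le> 1"
    unfolding hexagon_def xc_simps yc_simps by (simp add: algebra_simps)
  moreover have "\<bar>a\<bar> < 1" if "\<bar>(1 + s) * a\<bar> \<le> 1" for a
  proof (cases "a = 0")
    case False
    then have "\<bar>a\<bar> < (1 + s) * \<bar>a\<bar>" using s by (simp add: algebra_simps)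
    then show ?thesis using that s by (simp add: abs_mult)
  qed simp
  ultimately show "\<bar>xc z\<bar> < 1 \<and> \<bar>yc z\<bar> < 1 \<and> \<bar>xc z - yc z\<bar> < 1" by blast
next
  let ?S = "{z. \<bar>xc z\<bar> < 1 \<and> \<bar>yc z\<bar> < 1 \<and> \<bar>xc z - yc z\<bar> < 1}"
  assume "\<bar>xc z\<bar> < 1 \<and> \<bar>yc z\<bar> < 1 \<and> \<bar>xc z - yc z\<bar> < 1"
  moreover have "open ?S"
    unfolding xc_def yc_def by (intro open_Collect_conj open_Collect_less continuous_intros)
  moreover have "?S \<subseteq> voronoi_cell \<tau>"
    by (auto simp: voronoi_cell_iff hexagon_def)
  ultimately show "z \<in> interior (voronoi_cell \<tau>)"
    by (auto intro: interiorI)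
qed

lemma voronoi_vertices_eq:
  "voronoi_vertices \<tau> = (let t = Im \<zeta> in
     [Complex (1/2) (1 / (4 * t)), Complex 0 (1 / (2 * t)), Complex (-1/2) (1 / (4 * t)),
      Complex (-1/2) (- 1 / (4 * t)), Complex 0 (- 1 / (2 * t)), Complex (1/2) (- 1 / (4 * t))])"
proof -
  have fr: "frac (Re \<tau>) = 1/2"
    by (simp add: tau Re_zeta frac_unique_iff)
  have im: "Im \<tau> = Im \<zeta>" by (simp add: tau)
  have v0: "((Im \<zeta>)\<^sup>2 + (1/2)\<^sup>2 - 1/2) / (2 * Im \<zeta>) = 1 / (4 * Im \<zeta>)"
    and v1: "((Im \<zeta>)\<^sup>2 - (1/2)\<^sup>2 + 1/2) / (2 * Im \<zeta>) = 1 / (2 * Im \<zeta>)"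
    using Im_zeta_nonzero by (simp_all add: Im_zeta_square power_divide)
  show ?thesis
    unfolding voronoi_vertices_def fr im Let_def v0 v1
    using Im_zeta_nonzero by (auto simp: complex_eq_iff field_simps)
qed

lemma length_voronoi_vertices: "length (voronoi_vertices \<tau>) = 6"
  by (simp add: voronoi_vertices_eq Let_def)

lemma xc_vertices: "map xc (voronoi_vertices \<tau>) = [1, 0, -1, -1, 0, 1]"
  by (simp add: voronoi_vertices_eq Let_def xc_def)

lemma yc_vertices: "map yc (voronoi_vertices \<tau>) = [1, 1, 0, -1, -1, 0]"
  using Im_zeta_nonzero by (simp add: voronoi_vertices_eq Let_def yc_def)

lemma vertex_coords:
  "xc (voronoi_vertex \<tau> k) = [1, 0, -1, -1, 0, 1] ! (k mod 6)"
  "yc (voronoi_vertex \<tau> k) = [1, 1, 0, -1, -1, 0] ! (k mod 6)"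
  by (simp_all add: voronoi_vertex_def length_voronoi_vertices flip: xc_vertices yc_vertices)

text \<open>The parameter \<open>u\<close> runs along the whole segment from \<open>a\<close> to \<open>b\<close>, so the half beyond the
midpoint is \<open>1/2 < u < 1\<close>.\<close>

lemma half_edge_iff:
  assumes "a \<noteq> b"
  shows "z \<in> open_segment (midpoint a b) b \<longleftrightarrow>
    (\<exists>u. 1/2 < u \<and> u < 1 \<and> xc z = (1 - u) * xc a + u * xc b \<and> yc z = (1 - u) * yc a + u * yc b)"
    (is "_ \<longleftrightarrow> (\<exists>u. ?P u)")
proof -
  have point: "?P u \<longleftrightarrow> 1/2 < u \<and> u < 1 \<and> z = of_real (1 - u) * a + of_real u * b" for u
    by (simp only: eq_iff_coords[of z] xc_simps yc_simps)
  have mid: "of_real (1 - s) * midpoint a b + of_real s * b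
      = of_real (1 - (1 + s) / 2) * a + of_real ((1 + s) / 2) * b" for s :: real
    by (simp add: midpoint_def scaleR_conv_of_real field_simps)
  have "z \<in> open_segment (midpoint a b) b \<longleftrightarrow>
      (\<exists>s. 0 < s \<and> s < 1 \<and> z = of_real (1 - s) * midpoint a b + of_real s * b)"
    using assms by (simp add: in_segment scaleR_conv_of_real)
  also have "\<dots> \<longleftrightarrow> (\<exists>u. 1/2 < u \<and> u < 1 \<and> z = of_real (1 - u) * a + of_real u * b)"
  proof
    assume "\<exists>s. 0 < s \<and> s < 1 \<and> z = of_real (1 - s) * midpoint a b + of_real s * b"
    then obtain s where "0 < s" "s < 1" "z = of_real (1 - s) * midpoint a b + of_real s * b" by blast
    then show "\<exists>u. 1/2 < u \<and> u < 1 \<and> z = of_real (1 - u) * a + of_real u * b"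
      unfolding mid by (intro exI[of _ "(1 + s) / 2"]) auto
  next
    assume "\<exists>u. 1/2 < u \<and> u < 1 \<and> z = of_real (1 - u) * a + of_real u * b"
    then obtain u where u: "1/2 < u" "u < 1" "z = of_real (1 - u) * a + of_real u * b" by blast
    then have "z = of_real (1 - (2 * u - 1)) * midpoint a b + of_real (2 * u - 1) * b"
      unfolding mid by simp
    then show "\<exists>s. 0 < s \<and> s < 1 \<and> z = of_real (1 - s) * midpoint a b + of_real s * b"
      using u by (intro exI[of _ "2 * u - 1"]) auto
  qed
  finally show ?thesis unfolding point .
qed

lemma half_edges_iff:
  fixes z :: complex
  defines "x \<equiv> xc z" and "y \<equiv> yc z"
  shows "z \<in> (\<Union>k<6. open_segment (voronoi_edge_midpoint \<tau> k) (voronoi_vertex \<tau> (k + 1))) \<longleftrightarrow>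
      (y = 1 \<and> 1/2 < y - x \<and> y - x < 1) \<or> (y - x = 1 \<and> 1/2 < - x \<and> - x < 1)
    \<or> (x = - 1 \<and> 1/2 < - y \<and> - y < 1) \<or> (y = - 1 \<and> 1/2 < x - y \<and> x - y < 1)
    \<or> (x - y = 1 \<and> 1/2 < x \<and> x < 1) \<or> (x = 1 \<and> 1/2 < y \<and> y < 1)"
proof -
  have edge: "z \<in> open_segment (voronoi_edge_midpoint \<tau> k) (voronoi_vertex \<tau> (k + 1)) \<longleftrightarrow>
      (\<exists>u. 1/2 < u \<and> u < 1
        \<and> x = (1 - u) * [1, 0, -1, -1, 0, 1] ! k + u * [1, 0, -1, -1, 0, 1] ! ((k + 1) mod 6)
        \<and> y = (1 - u) * [1, 1, 0, -1, -1, 0] ! k + u * [1, 1, 0, -1, -1, 0] ! ((k + 1) mod 6))"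
    if "k < 6" for k
  proof -
    have "k \<in> {0, 1, 2, 3, 4, 5}" using that by auto
    then have "voronoi_vertex \<tau> k \<noteq> voronoi_vertex \<tau> (k + 1)"
      by (auto simp: eq_iff_coords vertex_coords)
    then show ?thesis
      unfolding voronoi_edge_midpoint_def x_def y_def
      by (simp add: half_edge_iff vertex_coords that)
  qed
  have "{..<6 :: nat} = {0, 1, 2, 3, 4, 5}" by auto
  then have "z \<in> (\<Union>k<6. open_segment (voronoi_edge_midpoint \<tau> k) (voronoi_vertex \<tau> (k + 1))) \<longleftrightarrow>
      (\<exists>u. 1/2 < u \<and> u < 1 \<and> x = 1 - u \<and> y = 1)
    \<or> (\<exists>u. 1/2 < u \<and> u < 1 \<and> x = - u \<and> y = 1 - u)
    \<or> (\<exists>u. 1/2 < u \<and> u < 1 \<and> x = - 1 \<and> y = - u)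
    \<or> (\<exists>u. 1/2 < u \<and> u < 1 \<and> x = u - 1 \<and> y = - 1)
    \<or> (\<exists>u. 1/2 < u \<and> u < 1 \<and> x = u \<and> y = u - 1)
    \<or> (\<exists>u. 1/2 < u \<and> u < 1 \<and> x = 1 \<and> y = u)"
    using edge[of 0] edge[of 1] edge[of 2] edge[of 3] edge[of 4] edge[of 5]
    by simp
  moreover have "(\<exists>u. 1/2 < u \<and> u < 1 \<and> x = 1 - u \<and> y = 1) \<longleftrightarrow> y = 1 \<and> 1/2 < y - x \<and> y - x < 1"
    by (auto intro!: exI[of _ "y - x"])
  moreover have "(\<exists>u. 1/2 < u \<and> u < 1 \<and> x = - u \<and> y = 1 - u) \<longleftrightarrow> y - x = 1 \<and> 1/2 < - x \<and> - x < 1"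
    by (auto intro!: exI[of _ "- x"])
  moreover have "(\<exists>u. 1/2 < u \<and> u < 1 \<and> x = - 1 \<and> y = - u) \<longleftrightarrow> x = - 1 \<and> 1/2 < - y \<and> - y < 1"
    by (auto intro!: exI[of _ "- y"])
  moreover have "(\<exists>u. 1/2 < u \<and> u < 1 \<and> x = u - 1 \<and> y = - 1) \<longleftrightarrow> y = - 1 \<and> 1/2 < x - y \<and> x - y < 1"
    by (auto intro!: exI[of _ "x - y"])
  moreover have "(\<exists>u. 1/2 < u \<and> u < 1 \<and> x = u \<and> y = u - 1) \<longleftrightarrow> x - y = 1 \<and> 1/2 < x \<and> x < 1"
    by (auto intro!: exI[of _ x])
  moreover have "(\<exists>u. 1/2 < u \<and> u < 1 \<and> x = 1 \<and> y = u) \<longleftrightarrow> x = 1 \<and> 1/2 < y \<and> y < 1"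
    by auto
  ultimately show ?thesis by simp
qed

lemma vertex_coords_Ints: "xc (voronoi_vertex \<tau> k) \<in> \<int>" "yc (voronoi_vertex \<tau> k) \<in> \<int>"
proof -
  have "k mod 6 \<in> {0, 1, 2, 3, 4, 5}" by auto
  then show "xc (voronoi_vertex \<tau> k) \<in> \<int>" "yc (voronoi_vertex \<tau> k) \<in> \<int>"
    unfolding vertex_coords by auto
qed

text \<open>The selected vertices and midpoints of sides are half-integral in both coordinates; away from
such points the restricted cell treats all six sides alike.\<close>

lemma restricted_voronoi_cell_iff:
  assumes nondeg: "2 * xc z \<notin> \<int> \<or> 2 * yc z \<notin> \<int>"
  shows "z \<in> restricted_voronoi_cell \<tau> \<longleftrightarrow> half_open_hexagon (xc z) (yc z)"
proof -
  have vertex: "z \<noteq> voronoi_vertex \<tau> k" for k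
    using nondeg vertex_coords_Ints[of k] by (auto intro: Ints_mult)
  have midpoint: "z \<noteq> voronoi_edge_midpoint \<tau> k" for k
  proof
    assume "z = voronoi_edge_midpoint \<tau> k"
    then have "of_real 2 * z = voronoi_vertex \<tau> k + voronoi_vertex \<tau> (k + 1)"
      by (simp add: voronoi_edge_midpoint_def midpoint_def scaleR_conv_of_real mult.commute)
    then have "2 * xc z = xc (voronoi_vertex \<tau> k) + xc (voronoi_vertex \<tau> (k + 1))"
      "2 * yc z = yc (voronoi_vertex \<tau> k) + yc (voronoi_vertex \<tau> (k + 1))"
      by (metis xc_simps(1,4), metis yc_simps(1,4))
    then show False using nondeg vertex_coords_Ints Ints_add by metis
  qed
  have "z \<in> restricted_voronoi_cell \<tau> \<longleftrightarrow> z \<in> interior (voronoi_cell \<tau>)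
      \<or> z \<in> (\<Union>k<6. open_segment (voronoi_edge_midpoint \<tau> k) (voronoi_vertex \<tau> (k + 1)))"
    using vertex midpoint
    unfolding restricted_voronoi_cell_def Let_def length_voronoi_vertices by blast
  then show ?thesis
    unfolding interior_voronoi_cell_iff half_edges_iff half_open_hexagon_iff .
qed

end

section \<open>Digits modulo powers of the ramified prime\<close>

text \<open>The polynomials \<open>X\<^sup>2 - 3X + 3\<close> and \<open>X\<^sup>2 + 3X + 3\<close> have the roots \<open>1 + \<zeta>\<close> and \<open>\<zeta> - 2\<close>
respectively.\<close>

locale eisenstein_digits = eisenstein +
  fixes w :: nat
  assumes c: "c = 1 \<or> c = - 2" and w: "2 \<le> w"
begin

abbreviation R where "R \<equiv> int_adjoin \<tau>"
abbreviation D where "D \<equiv> min_norm_digit_set \<tau> w"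

lemma tau_lattice_point: "\<tau> = lattice_point c 1"
  by (simp add: tau lattice_point_def)

lemma norm_tau_square: "(norm \<tau>)\<^sup>2 = 3"
  using c unfolding tau_lattice_point norm_square_lattice_point by auto

lemma norm_tau: "norm \<tau> = sqrt 3"
  using norm_tau_square by (metis norm_ge_zero real_sqrt_unique)

lemma tau_nonzero: "\<tau> \<noteq> 0"
  using norm_tau_square by auto

lemma tau_in: "\<tau> \<in> R"
  by (metis tau_lattice_point lattice_point_in)

lemma tau_pow_in: "\<tau> ^ n \<in> R"
  using of_int_in[of 1] by (induction n) (auto intro: int_adjoin_closed tau_in)

text \<open>The prime 3 is ramified: up to a unit it is the square of \<open>\<tau>\<close>.\<close>

lemma three_eq_tau_square:
  obtains u v where "u \<in> R" "v \<in> R" "u * v = 1" "3 = \<tau>\<^sup>2 * u"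
proof -
  have inv: "lattice_point 0 1 * lattice_point 1 (- 1) = 1"
    by (simp add: lattice_point_mult) (simp add: lattice_point_def)
  from c show ?thesis
  proof
    assume "c = 1"
    then have "3 = \<tau>\<^sup>2 * lattice_point 1 (- 1)"
      unfolding tau_lattice_point power2_eq_square lattice_point_mult
      by (simp add: lattice_point_def)
    then show ?thesis
      using inv by (intro that[of "lattice_point 1 (- 1)" "lattice_point 0 1"])
        (simp_all add: lattice_point_in mult.commute)
  next
    assume "c = - 2"
    then have "3 = \<tau>\<^sup>2 * lattice_point 0 1"
      unfolding tau_lattice_point power2_eq_square lattice_point_mult
      by (simp add: lattice_point_def)
    then show ?thesis
      using inv by (intro that[of "lattice_point 0 1" "lattice_point 1 (- 1)"])
        (simp_all add: lattice_point_in)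
  qed
qed

text \<open>Up to a unit, \<open>\<tau>\<close> is \<open>1 + \<zeta>\<close>, and \<open>m + n\<zeta> = (m - n) + n(1 + \<zeta>)\<close>.\<close>

lemma tau_dvd_lattice_point:
  assumes "3 dvd m - n"
  shows "dvd_in R \<tau> (lattice_point m n)"
proof -
  obtain k where k: "m - n = 3 * k" using assms by (elim dvdE)
  then have m: "m = n + 3 * k" by simp
  from c have "lattice_point m n = \<tau> * lattice_point (n + 2 * k) (- k)
      \<or> lattice_point m n = \<tau> * lattice_point (- k) (- n - k)"
    unfolding tau_lattice_point lattice_point_mult m by (auto simp: add.commute)
  then show ?thesis using lattice_point_in unfolding dvd_in_def by blast
qed

text \<open>The norm form \<open>m\<^sup>2 + mn + n\<^sup>2\<close> is congruent to \<open>(m - n)\<^sup>2\<close> modulo 3.\<close>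

lemma norm_square_not_dvd:
  assumes "z \<in> R" "\<not> dvd_in R \<tau> z"
  obtains k :: int where "(norm z)\<^sup>2 = of_int k" "k mod 3 = 1"
proof -
  obtain m n where z: "z = lattice_point m n" using assms(1) by (elim lattice_pointE)
  have "\<not> 3 dvd m - n" using assms(2) z tau_dvd_lattice_point by blast
  then have "(m - n) mod 3 = 1 \<or> (m - n) mod 3 = 2" by presburger
  moreover have "(m - n)\<^sup>2 mod 3 = ((m - n) mod 3)\<^sup>2 mod 3" by (simp add: power_mod)
  ultimately have "(m - n)\<^sup>2 mod 3 = 1" by auto
  moreover have "m\<^sup>2 + m * n + n\<^sup>2 = (m - n)\<^sup>2 + 3 * (m * n)"
    by (simp add: power2_eq_square algebra_simps)
  ultimately have "(m\<^sup>2 + m * n + n\<^sup>2) mod 3 = 1" by (metis mod_mult_self2)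
  then show ?thesis using that norm_square_lattice_point z by blast
qed

lemma dvd_in_diff_pow:
  assumes "y \<in> R" "dvd_in R \<tau> (z - \<tau> ^ w * y)"
  shows "dvd_in R \<tau> z"
proof -
  obtain v where v: "v \<in> R" "z - \<tau> ^ w * y = \<tau> * v" using assms(2) by (auto simp: dvd_in_def)
  have "w = Suc (w - 1)" using w by simp
  then have "\<tau> ^ w = \<tau> * \<tau> ^ (w - 1)" by (metis power_Suc)
  then have "z = \<tau> * (v + \<tau> ^ (w - 1) * y)" using v(2) by (simp add: algebra_simps)
  moreover have "v + \<tau> ^ (w - 1) * y \<in> R"
    by (intro int_adjoin_closed v(1) assms(1) tau_pow_in)
  ultimately show ?thesis unfolding dvd_in_def by blast
qed

text \<open>This keeps digits away from the vertices and the midpoints of sides. If both coordinates of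
\<open>q = z / \<tau> ^ w\<close> are half-integral, then \<open>6q\<close> is a multiple of \<open>\<tau>\<close>, and since 3 is \<open>\<tau>\<^sup>2\<close> times a
unit, \<open>2\<tau>q\<close> lies in the ring. So \<open>2z = \<tau> ^ (w - 1) * (2\<tau>q)\<close> is divisible by \<open>\<tau>\<close> because
\<open>w \<ge> 2\<close>, and with \<open>3z\<close> also \<open>z\<close> is.\<close>

lemma quotient_coords_not_half_integral:
  assumes "z \<in> R" "\<not> dvd_in R \<tau> z"
  shows "2 * xc (z / \<tau> ^ w) \<notin> \<int> \<or> 2 * yc (z / \<tau> ^ w) \<notin> \<int>"
proof (rule ccontr)
  define q where "q = z / \<tau> ^ w"
  assume "\<not> ?thesis"
  then obtain a b :: int where ab: "2 * xc q = a" "2 * yc q = b"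
    by (auto simp: q_def elim!: Ints_cases)
  have "of_real 6 * q = lattice_point (2 * a - b) (2 * b - a)"
    unfolding eq_iff_coords xc_simps yc_simps yc_lattice_point using ab by simp
  moreover have "3 dvd (2 * a - b) - (2 * b - a)" by presburger
  ultimately obtain g where g: "g \<in> R" "6 * q = \<tau> * g"
    using tau_dvd_lattice_point by (fastforce simp: dvd_in_def)
  obtain u v where uv: "u \<in> R" "v \<in> R" "u * v = 1" "3 = \<tau>\<^sup>2 * u"
    by (rule three_eq_tau_square)
  have "6 * q = \<tau> * (2 * \<tau> * u * q)" using uv(4) by (simp add: power2_eq_square mult.assoc)
  then have "2 * \<tau> * u * q = g" using g(2) tau_nonzero by simp
  then have "2 * \<tau> * q * (u * v) = g * v" by (metis mult.assoc mult.commute)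
  then have h: "2 * (\<tau> * q) = g * v" using uv(3) by (simp add: mult.assoc)
  have "w = Suc (Suc (w - 2))" using w by simp
  then have pw: "\<tau> ^ w = \<tau> * (\<tau> * \<tau> ^ (w - 2))" by (metis power_Suc)
  have "2 * z = 2 * (\<tau> ^ w * q)" using tau_nonzero by (simp add: q_def)
  also have "\<dots> = \<tau> * (\<tau> ^ (w - 2) * (2 * (\<tau> * q)))" by (simp add: pw)
  finally have two: "2 * z = \<tau> * (\<tau> ^ (w - 2) * (g * v))" unfolding h .
  have three: "3 * z = \<tau> * (\<tau> * u * z)" using uv(4) by (simp add: power2_eq_square mult.assoc)
  have "z = 3 * z - 2 * z" by simp
  then have "z = \<tau> * (\<tau> * u * z - \<tau> ^ (w - 2) * (g * v))"
    unfolding two three right_diff_distrib .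
  moreover have "\<tau> * u * z - \<tau> ^ (w - 2) * (g * v) \<in> R"
    by (intro int_adjoin_closed tau_in tau_pow_in g(1) uv(1,2) assms(1))
  ultimately have "dvd_in R \<tau> z" unfolding dvd_in_def by blast
  then show False using assms(2) by simp
qed

text \<open>A description of the nonzero digits in which all six sides of the cell play the same part.\<close>

lemma digit_iff:
  "d \<in> D - {0} \<longleftrightarrow> d \<in> R \<and> \<not> dvd_in R \<tau> d \<and> half_open_hexagon (xc (d / \<tau> ^ w)) (yc (d / \<tau> ^ w))"
proof -
  have "d \<in> (\<lambda>v. \<tau> ^ w * v) ` restricted_voronoi_cell \<tau> \<longleftrightarrow> d / \<tau> ^ w \<in> restricted_voronoi_cell \<tau>"
    using tau_nonzero by (auto simp: image_iff intro!: bexI[of _ "d / \<tau> ^ w"])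
  moreover have "dvd_in R \<tau> 0" using of_int_in[of 0] by (auto simp: dvd_in_def)
  ultimately show ?thesis
    using restricted_voronoi_cell_iff[OF quotient_coords_not_half_integral, of d]
    unfolding min_norm_digit_set_def by auto
qed

lemma digits_incongruent:
  assumes "a \<in> D - {0}" "b \<in> D - {0}" "dvd_in R (\<tau> ^ w) (a - b)"
  shows "a = b"
proof -
  obtain m n where mn: "a - b = \<tau> ^ w * lattice_point m n"
    using assms(3) by (auto simp: dvd_in_def elim!: lattice_pointE)
  then have "b / \<tau> ^ w = a / \<tau> ^ w - lattice_point m n"
    using tau_nonzero by (simp add: field_simps)
  then have "m = 0 \<and> n = 0"
    using assms(1,2) half_open_hexagon_disjoint[of "xc (a / \<tau> ^ w)" "yc (a / \<tau> ^ w)" m n]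
    unfolding digit_iff by (simp only: xc_simps yc_simps yc_lattice_point)
  then show ?thesis using mn by (simp add: lattice_point_def)
qed

lemma digit_exists:
  assumes "z \<in> R" "\<not> dvd_in R \<tau> z"
  obtains d y where "d \<in> D - {0}" "y \<in> R" "z = d + \<tau> ^ w * y"
proof -
  obtain m n where mn: "half_open_hexagon (xc (z / \<tau> ^ w) - of_int (2 * m + n))
      (yc (z / \<tau> ^ w) - of_int (m + 2 * n))"
    using half_open_hexagon_covers[OF quotient_coords_not_half_integral[OF assms]] by blast
  define d where "d = z - \<tau> ^ w * lattice_point m n"
  have "d / \<tau> ^ w = z / \<tau> ^ w - lattice_point m n"
    using tau_nonzero by (simp add: d_def field_simps)
  then have "half_open_hexagon (xc (d / \<tau> ^ w)) (yc (d / \<tau> ^ w))"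
    using mn by (simp only: xc_simps yc_simps yc_lattice_point)
  moreover have "d \<in> R"
    unfolding d_def by (intro int_adjoin_closed assms(1) tau_pow_in lattice_point_in)
  moreover have "\<not> dvd_in R \<tau> d"
    using assms(2) dvd_in_diff_pow lattice_point_in unfolding d_def by blast
  ultimately have "d \<in> D - {0}" unfolding digit_iff by blast
  moreover have "z = d + \<tau> ^ w * lattice_point m n" by (simp add: d_def)
  ultimately show ?thesis using that lattice_point_in by blast
qed

text \<open>The cell \<open>\<tau> ^ w * V\<close> has inradius \<open>sqrt 3 ^ w / 2\<close>.\<close>

lemma short_is_digit:
  assumes "z \<in> R" "\<not> dvd_in R \<tau> z" "2 * norm z < sqrt 3 ^ w"
  shows "z \<in> D - {0}"
proof -
  define x y where "x = xc (z / \<tau> ^ w)" and "y = yc (z / \<tau> ^ w)"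
  have "norm (z / \<tau> ^ w) < 1/2"
    using assms(3) by (simp add: norm_divide norm_power norm_tau pos_divide_less_eq)
  then have "(norm (z / \<tau> ^ w))\<^sup>2 < (1/2)\<^sup>2"
    by (intro power_strict_mono) auto
  then have lt: "x\<^sup>2 - x * y + y\<^sup>2 < 3/4"
    by (simp add: norm_square_coords x_def y_def power_divide)
  have "x\<^sup>2 - x * y + y\<^sup>2 = 3/4 * x\<^sup>2 + (y - x / 2)\<^sup>2"
    "x\<^sup>2 - x * y + y\<^sup>2 = 3/4 * y\<^sup>2 + (x - y / 2)\<^sup>2"
    "x\<^sup>2 - x * y + y\<^sup>2 = 3/4 * (x - y)\<^sup>2 + ((x + y) / 2)\<^sup>2"
    by (simp_all add: power2_eq_square field_simps)
  then have "x\<^sup>2 < 1" "y\<^sup>2 < 1" "(x - y)\<^sup>2 < 1"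
    using lt zero_le_power2[of "y - x / 2"] zero_le_power2[of "x - y / 2"]
      zero_le_power2[of "(x + y) / 2"] by linarith+
  then have "half_open_hexagon x y"
    by (simp add: half_open_hexagon_iff abs_square_less_1)
  then show ?thesis using assms(1,2) unfolding digit_iff x_def y_def by blast
qed

text \<open>The cell \<open>\<tau> ^ w * V\<close> has circumradius \<open>sqrt 3 ^ (w - 1)\<close>.\<close>

lemma digit_norm_square_le:
  assumes "d \<in> D - {0}"
  shows "(norm d)\<^sup>2 \<le> 3 ^ (w - 1)"
proof -
  have "half_open_hexagon (xc (d / \<tau> ^ w)) (yc (d / \<tau> ^ w))"
    using assms unfolding digit_iff by blast
  then have "hexagon (xc (d / \<tau> ^ w)) (yc (d / \<tau> ^ w))"
    unfolding half_open_hexagon_def by blast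
  from hexagon_quadratic_le[OF this] have "(norm (d / \<tau> ^ w))\<^sup>2 \<le> 1/3"
    unfolding norm_square_coords by simp
  moreover have "(norm (d / \<tau> ^ w))\<^sup>2 = (norm d)\<^sup>2 / 3 ^ w"
    by (simp add: norm_divide norm_power power_divide norm_tau power2_eq_square
        flip: power_mult_distrib)
  ultimately have "(norm d)\<^sup>2 \<le> 3 ^ w / 3" by (simp add: field_simps)
  also have "3 ^ w / 3 = (3 :: real) ^ (w - 1)"
    using w by (simp add: power_diff)
  finally show ?thesis .
qed

text \<open>The estimate behind the merging of digits. The circumradius suffices as a bound for the digits
when \<open>w \<ge> 4\<close>. For \<open>w = 2\<close> and \<open>w = 3\<close> it is slightly too large, and one uses that the
squared norm of a digit is congruent to 1 modulo 3: being at most 3 or 9, it is at most 1 or 7.\<close>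

lemma digits_short:
  assumes "a \<in> D - {0}" "b \<in> D - {0}" "e \<in> D - {0}"
  shows "2 * (norm a + sqrt 3 ^ (w - 1) * norm b + norm e) < 3 ^ w"
proof -
  define p where "p = sqrt 3 ^ (w - 1)"
  have p2: "p\<^sup>2 = 3 ^ (w - 1)"
    unfolding p_def by (simp add: power_mult[symmetric] mult.commute power_mult)
  have p0: "0 \<le> p" by (simp add: p_def)
  have bound: "2 * (norm a + p * norm b + norm e) < 3 ^ w"
    if B: "\<And>d. d \<in> D - {0} \<Longrightarrow> norm d \<le> B" and "2 * (2 + p) * B < 3 ^ w" for B
  proof -
    have "p * norm b \<le> p * B" using B[OF assms(2)] p0 by (rule mult_left_mono)
    then have "2 * (norm a + p * norm b + norm e) \<le> 2 * (B + p * B + B)"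
      using B[OF assms(1)] B[OF assms(3)] by simp
    then show ?thesis using that(2) by (simp add: algebra_simps)
  qed
  consider "w = 2" | "w = 3" | "4 \<le> w" using w by linarith
  then have "2 * (norm a + p * norm b + norm e) < 3 ^ w"
  proof cases
    case 1
    have "norm d \<le> 1" if d: "d \<in> D - {0}" for d
    proof -
      have "d \<in> R" "\<not> dvd_in R \<tau> d" using d unfolding digit_iff by blast+
      then obtain k :: int where k: "(norm d)\<^sup>2 = of_int k" "k mod 3 = 1"
        by (rule norm_square_not_dvd)
      have "k \<le> 3" using digit_norm_square_le[OF d] k(1) 1 by simp
      then have "k \<le> 1" using k(2) by presburger
      then have "(norm d)\<^sup>2 \<le> 1" using k(1) by simp
      then show ?thesis by (simp add: power_le_one_iff abs_square_le_1)
    qed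
    moreover have "2 * (2 + p) * 1 < 3 ^ w"
    proof -
      have "sqrt 3 < 2" by (rule real_less_lsqrt) auto
      then show ?thesis using 1 by (simp add: p_def)
    qed
    ultimately show ?thesis by (rule bound)
  next
    case 2
    have "norm d \<le> sqrt 7" if d: "d \<in> D - {0}" for d
    proof -
      have "d \<in> R" "\<not> dvd_in R \<tau> d" using d unfolding digit_iff by blast+
      then obtain k :: int where k: "(norm d)\<^sup>2 = of_int k" "k mod 3 = 1"
        by (rule norm_square_not_dvd)
      have "k \<le> 9" using digit_norm_square_le[OF d] k(1) 2 by simp
      then have "k \<le> 7" using k(2) by presburger
      then have "(norm d)\<^sup>2 \<le> 7" using k(1) by simp
      then show ?thesis by (rule real_le_rsqrt)
    qed
    moreover have "2 * (2 + p) * sqrt 7 < 3 ^ w"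
    proof -
      \<comment> \<open>Here \<open>2 * (2 + p)\<close> is 10 and \<open>3 ^ w\<close> is 27.\<close>
      have "sqrt 7 < 2.7" by (rule real_less_lsqrt) (auto simp: power2_eq_square)
      then show ?thesis using 2 by (simp add: p_def)
    qed
    ultimately show ?thesis by (rule bound)
  next
    case 3
    have "norm d \<le> p" if d: "d \<in> D - {0}" for d
      using digit_norm_square_le[OF d] p0 unfolding p2[symmetric] by (rule power2_le_imp_le)
    moreover have "2 * (2 + p) * p < 3 ^ w"
    proof -
      have "(3 :: real) ^ 3 \<le> 3 ^ (w - 1)" using 3 by (intro power_increasing) auto
      then have "4\<^sup>2 < p\<^sup>2" unfolding p2 by simp
      then have "4 < p" using p0 by (rule power2_less_imp_less)
      then have "4 * p < p * p" by simp
      moreover have "(3 :: real) ^ w = 3 * p\<^sup>2"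
        unfolding p2 using w by (metis One_nat_def Suc_1 Suc_le_lessD power_minus_mult mult.commute
            gr_zeroI not_less_zero)
      ultimately show ?thesis by (simp add: power2_eq_square algebra_simps)
    qed
    ultimately show ?thesis by (rule bound)
  qed
  then show ?thesis by (simp add: p_def)
qed

lemma tau_adic:
  assumes "z \<in> R" "z \<noteq> 0"
  obtains j y where "z = \<tau> ^ j * y" "y \<in> R" "\<not> dvd_in R \<tau> y"
proof -
  have "\<exists>j y. z = \<tau> ^ j * y \<and> y \<in> R \<and> \<not> dvd_in R \<tau> y"
    if "z \<in> R" "z \<noteq> 0" "(norm z)\<^sup>2 < 3 ^ n" for n z
    using that
  proof (induction n arbitrary: z)
    case 0
    obtain m n where z: "z = lattice_point m n" using 0(1) by (elim lattice_pointE)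
    have "real_of_int (m\<^sup>2 + m * n + n\<^sup>2) < 1"
      using 0(3) unfolding z norm_square_lattice_point by simp
    then have "m\<^sup>2 + m * n + n\<^sup>2 \<le> 0" by linarith
    then have "(norm z)\<^sup>2 \<le> 0" unfolding z norm_square_lattice_point by linarith
    then show ?case using 0(2) by simp
  next
    case (Suc n)
    show ?case
    proof (cases "dvd_in R \<tau> z")
      case False
      then show ?thesis using Suc.prems(1) by (intro exI[of _ 0] exI[of _ z]) simp
    next
      case True
      then obtain y where y: "y \<in> R" "z = \<tau> * y" by (auto simp: dvd_in_def)
      have "(norm z)\<^sup>2 = 3 * (norm y)\<^sup>2"
        by (simp add: y(2) norm_mult power_mult_distrib norm_tau_square)
      then have "(norm y)\<^sup>2 < 3 ^ n" using Suc.prems(3) by simp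
      moreover have "y \<noteq> 0" using Suc.prems(2) y(2) by auto
      ultimately obtain j x where "y = \<tau> ^ j * x" "x \<in> R" "\<not> dvd_in R \<tau> x"
        using Suc.IH y(1) by blast
      then have "z = \<tau> ^ Suc j * x \<and> x \<in> R \<and> \<not> dvd_in R \<tau> x" by (simp add: y(2) mult.assoc)
      then show ?thesis by blast
    qed
  qed
  moreover obtain n where "(norm z)\<^sup>2 < 3 ^ n"
    using real_arch_pow[of 3] by force
  ultimately show ?thesis using assms that by blast
qed

lemma norm_le_tau_pow_mult: "norm y \<le> norm (\<tau> ^ j * y)"
proof -
  have "1 \<le> sqrt 3 ^ j" by (rule one_le_power) simp
  then have "1 * norm y \<le> sqrt 3 ^ j * norm y" by (rule mult_right_mono) simp
  then show ?thesis by (simp add: norm_mult norm_power norm_tau)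
qed

text \<open>After taking out the powers of \<open>\<tau>\<close>, the sum is \<open>s = e + \<tau> ^ w * g\<close> with a digit \<open>e\<close>. By
the size estimate \<open>g\<close> lies in the open disc inscribed in \<open>\<tau> ^ w * V\<close>, and so does its part prime to
\<open>\<tau>\<close>, which is therefore a digit: \<open>g\<close> costs a single term, and that term sits at place \<open>w\<close> or
above.\<close>

lemma digit_merge:
  assumes a: "a \<in> D - {0}" and b: "b \<in> D - {0}" and k: "k < w"
  shows "\<exists>N. is_multi_expansion \<tau> D (a + \<tau> ^ k * b) N \<and> size N \<le> 2
    \<and> size {#x \<in># N. snd x < w#} \<le> 1"
proof (cases "a + \<tau> ^ k * b = 0")
  case True
  then show ?thesis by (intro exI[of _ "{#}"]) (simp add: is_multi_expansion_def)
next
  case False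
  have "a + \<tau> ^ k * b \<in> R"
    using a b unfolding digit_iff by (intro int_adjoin_closed tau_pow_in) simp_all
  then obtain i s where s: "a + \<tau> ^ k * b = \<tau> ^ i * s" "s \<in> R" "\<not> dvd_in R \<tau> s"
    using tau_adic False by blast
  obtain e g where e: "e \<in> D - {0}" and g: "g \<in> R" "s = e + \<tau> ^ w * g"
    using digit_exists[OF s(2,3)] by blast
  have sum: "a + \<tau> ^ k * b = e * \<tau> ^ i + \<tau> ^ (i + w) * g"
    unfolding s(1) g(2) by (simp add: power_add algebra_simps)
  show ?thesis
  proof (cases "g = 0")
    case True
    then show ?thesis using e sum
      by (intro exI[of _ "{#(e, i)#}"]) (simp add: is_multi_expansion_def)
  next
    case False
    then obtain j f where f: "g = \<tau> ^ j * f" "f \<in> R" "\<not> dvd_in R \<tau> f"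
      using tau_adic g(1) by blast
    have "norm s \<le> norm (a + \<tau> ^ k * b)" unfolding s(1) by (rule norm_le_tau_pow_mult)
    also have "\<dots> \<le> norm a + sqrt 3 ^ k * norm b"
      by (rule order_trans[OF norm_triangle_ineq]) (simp add: norm_mult norm_power norm_tau)
    also have "\<dots> \<le> norm a + sqrt 3 ^ (w - 1) * norm b"
      using k by (intro add_left_mono mult_right_mono power_increasing) auto
    finally have s_le: "norm s \<le> norm a + sqrt 3 ^ (w - 1) * norm b" .
    have "sqrt 3 ^ w * norm g = norm (s - e)"
      by (simp add: g(2) norm_mult norm_power norm_tau)
    also have "\<dots> \<le> norm s + norm e" by (rule norm_triangle_ineq4)
    also have "\<dots> \<le> norm a + sqrt 3 ^ (w - 1) * norm b + norm e"
      using s_le by (rule add_right_mono)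
    finally have "2 * (sqrt 3 ^ w * norm g) \<le> 2 * (norm a + sqrt 3 ^ (w - 1) * norm b + norm e)"
      by (rule mult_left_mono) simp
    also have "\<dots> < 3 ^ w" by (rule digits_short[OF a b e])
    also have "(3 :: real) ^ w = sqrt 3 ^ w * sqrt 3 ^ w"
      by (simp flip: power_mult_distrib)
    finally have "2 * norm g < sqrt 3 ^ w" by simp
    moreover have "norm f \<le> norm g" unfolding f(1) by (rule norm_le_tau_pow_mult)
    ultimately have "f \<in> D - {0}" using short_is_digit f(2,3) by simp
    then show ?thesis using e sum
      by (intro exI[of _ "{#(e, i), (f, i + w + j)#}"])
        (simp add: is_multi_expansion_def f(1) power_add)
  qed
qed

sublocale digit_system \<tau> R D w
proof unfold_locales
  show zero: "0 \<in> R" using of_int_in[of 0] by simp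
  show "0 < w" using w by simp
  show "D \<subseteq> R" using zero unfolding min_norm_digit_set_def by blast
  show "\<not> dvd_in R \<tau> d" if "d \<in> D - {0}" for d
    using that unfolding digit_iff by blast
qed (fact tau_nonzero tau_in int_adjoin_closed digits_incongruent digit_merge)+

end

theorem corollary8p1:
  fixes \<mu> p q :: int and \<tau> :: complex and w :: nat and D :: "complex set"
  assumes "\<mu> \<in> {-1, 1}" and "p = 3 * \<mu>" and "q = 3"
    and "\<tau>\<^sup>2 - of_int p * \<tau> + of_int q = 0"
    and "w \<ge> 2"
    and "D = min_norm_digit_set \<tau> w"
  shows "\<forall>z \<in> int_adjoin \<tau>. \<forall>\<eta>. is_wNAF_expansion \<tau> w D z \<eta> \<longrightarrow> is_optimal_expansion \<tau> D z \<eta>"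
proof -
  \<comment> \<open>The integer for which \<open>\<tau> - c\<close> is a primitive sixth root of unity.\<close>
  define c :: int where "c = (if \<mu> = 1 then 1 else - 2)"
  have tau: "\<tau>\<^sup>2 = 3 * of_int \<mu> * \<tau> - 3"
    using assms(2-4) by (simp add: algebra_simps)
  have \<mu>: "\<mu> = 1 \<or> \<mu> = - 1" using assms(1) by auto
  then have "(\<tau> - of_int c)\<^sup>2 = (\<tau> - of_int c) - 1"
  proof
    assume "\<mu> = 1"
    then show ?thesis using tau by (simp add: c_def power2_diff)
  next
    assume "\<mu> = - 1"
    then show ?thesis using tau by (simp add: c_def power2_sum)
  qed
  then interpret eisenstein_digits "\<tau> - of_int c" \<tau> c w
    using assms(5) by unfold_locales (auto simp: c_def)
  show ?thesis unfolding assms(6) using wNAF_optimal by blast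
qed

end
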